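(* Let $X$ be a locally compact and separable metric space with Borel $\sigma$-algebra $\mathcal{B}$, and let $\mu : \mathcal{B} \to [0,\infty]$ be a Borel measure such that $\mu(O) > 0$ for all non-empty open sets $O \subset X$ and $\mu(K) < \infty$ for all compact sets $K \subset X$. Let $V \subset L^2(X,\mu)$ be a regular Dirichlet space which embeds (continuously and) densely into $L^1(X,\mu)$. Suppose that for every compact set $K \subset X$ there exist a function $y \in V$ and an open set $O \subset X$ with $K = O \cap \{y = 0\}$ up to a set of zero capacity. Assume further that there is a set $A \in \mathcal{B}$ with $\mu(A) = 0$ and $\operatorname{cap}(A) > 0$. Then the set $$M := \{ v \in L^\infty(X,\mu) \mid -1 \le v \le 1 \ \mu\text{-a.e. in } X \},$$ considered as a subset of the dual space $V^\star$, is not polyhedric.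
   Context: All function spaces are real. Dirichlet spaces: a subspace $V \subset L^2(X,\mu)$ is called a Dirichlet space if there exists a symmetric bilinear form $\mathcal{E} : V \times V \to \mathbb{R}$ such that (a) $V$ is dense in $L^2(X,\mu)$ and $\mathcal{E}(u,u) \ge 0$ for all $u \in V$; (b) $V$ is a Hilbert space when endowed with the inner product $\mathcal{E}_1(\cdot,\cdot) = \mathcal{E}(\cdot,\cdot) + (\cdot,\cdot)_{L^2}$; (c) for all $u \in V$ it holds $v := \min(1,\max(0,u)) \in V$ and $\mathcal{E}(v,v) \le \mathcal{E}(u,u)$. It is called regular if $V \cap C_c(X)$ is dense in $V$ with respect to the norm induced by $\mathcal{E}_1$ and $V \cap C_c(X)$ is dense in $C_c(X)$ with respect to the supremum norm, where $C_c(X)$ denotes the continuous functions with compact support. Capacity: for $A \subset X$, $\operatorname{cap}(A) := \inf\{ \mathcal{E}_1(u,u) \mid u \in V,\ u \ge 1 \ \mu\text{-a.e. on an open neighborhood of } A \}$ (with $\inf \emptyset = \infty$). A function $u : X \to \mathbb{R}$ is quasi-continuous if for every $\varepsilon > 0$ there is an open set $G \subset X$ with $\operatorname{cap}(G) < \varepsilon$ and $u|_{X\setminus G} \in C(X \setminus G)$. Every $v \in V$ has a quasi-continuous representative, unique up to sets of capacity zero; sets such as $\{y=0\}$ are always understood with respect to the (Borel measurable) quasi-continuous representative. Two sets are equal up to a set of zero capacity if their symmetric difference has capacity zero. Identification: since $V$ is continuously and densely embedded into $L^1(X,\mu)$, each $v \in L^\infty(X,\mu)$ is identified with the functional $u \mapsto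 \int_X v\,u\,\mathrm{d}\mu$ in $V^\star$. The set $M$ is convex, non-empty and closed in $V^\star$. Polyhedricity: for a closed, convex, non-empty subset $K$ of a Banach space $W$ and $w \in K$, let $\mathcal{R}_K(w) := \mathbb{R}^+(K - w)$, $\mathcal{T}_K(w) := \overline{\mathcal{R}_K(w)}$ (closure in $W$) and $\mathcal{N}_K(w) := \mathcal{T}_K(w)^\circ = \{\eta \in W^\star \mid \langle \eta, h\rangle \le 0 \ \forall h \in \mathcal{T}_K(w)\}$. For $\eta \in W^\star$ let $\eta^\perp \subset W$ denote the kernel of $\eta$. $K$ is polyhedric at $w \in K$ with respect to $\eta \in \mathcal{N}_K(w)$ if $\mathcal{T}_K(w) \cap \eta^\perp = \overline{\mathcal{R}_K(w) \cap \eta^\perp}$. $K$ is called polyhedric if it is polyhedric at every $w \in K$ with respect to all $\eta \in \mathcal{N}_K(w)$. Here this is applied with $W = V^\star$. *)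

theory Defs
  imports "HOL-Analysis.Analysis" "HOL-Library.Function_Algebras"
begin

text \<open>
  Real-valued functions form a real vector space under the pointwise operations. Function spaces
  and their duals are linear subspaces of such spaces.
\<close>

instantiation "fun" :: (type, real_vector) real_vector
begin

definition scaleR_fun :: "real \<Rightarrow> ('a \<Rightarrow> 'b) \<Rightarrow> 'a \<Rightarrow> 'b" where
  "scaleR_fun r f = (\<lambda>x. r *\<^sub>R f x)"

instance
  by standard (simp_all add: scaleR_fun_def fun_eq_iff algebra_simps)

end

text \<open>
  A space is given by a linear subspace \<open>W\<close> of some real vector space together with a (semi)norm
  \<open>N\<close> on it. Functionals are extended by zero outside \<open>W\<close>, so that each element of the dual is
  represented by exactly one function.
\<close>

definition linear_functional_on :: "'w::real_vector set \<Rightarrow> ('w \<Rightarrow> real) \<Rightarrow> bool" where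
  "linear_functional_on W \<phi> \<longleftrightarrow>
     (\<forall>u\<in>W. \<forall>v\<in>W. \<phi> (u + v) = \<phi> u + \<phi> v) \<and> (\<forall>c. \<forall>u\<in>W. \<phi> (c *\<^sub>R u) = c * \<phi> u)"

definition dual_space :: "'w::real_vector set \<Rightarrow> ('w \<Rightarrow> real) \<Rightarrow> ('w \<Rightarrow> real) set" where
  "dual_space W N =
     {\<phi>. linear_functional_on W \<phi> \<and> (\<exists>C. \<forall>u\<in>W. \<bar>\<phi> u\<bar> \<le> C * N u) \<and> (\<forall>u. u \<notin> W \<longrightarrow> \<phi> u = 0)}"

definition dual_norm :: "'w::real_vector set \<Rightarrow> ('w \<Rightarrow> real) \<Rightarrow> ('w \<Rightarrow> real) \<Rightarrow> real" where
  "dual_norm W N \<phi> = (SUP u\<in>{u\<in>W. N u \<le> 1}. \<bar>\<phi> u\<bar>)"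

definition norm_closure :: "'w::real_vector set \<Rightarrow> ('w \<Rightarrow> real) \<Rightarrow> 'w set \<Rightarrow> 'w set" where
  "norm_closure W N S = {x\<in>W. \<forall>e>0. \<exists>y\<in>S. N (x - y) < e}"

definition radial_cone :: "'w::real_vector set \<Rightarrow> 'w \<Rightarrow> 'w set" where
  "radial_cone K w = {t *\<^sub>R (k - w) | t k. t > 0 \<and> k \<in> K}"

definition tangent_cone :: "'w::real_vector set \<Rightarrow> ('w \<Rightarrow> real) \<Rightarrow> 'w set \<Rightarrow> 'w \<Rightarrow> 'w set" where
  "tangent_cone W N K w = norm_closure W N (radial_cone K w)"

definition normal_cone :: "'w::real_vector set \<Rightarrow> ('w \<Rightarrow> real) \<Rightarrow> 'w set \<Rightarrow> 'w \<Rightarrow> ('w \<Rightarrow> real) set" where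
  "normal_cone W N K w = {\<eta>\<in>dual_space W N. \<forall>h\<in>tangent_cone W N K w. \<eta> h \<le> 0}"

definition polyhedric_at ::
    "'w::real_vector set \<Rightarrow> ('w \<Rightarrow> real) \<Rightarrow> 'w set \<Rightarrow> 'w \<Rightarrow> ('w \<Rightarrow> real) \<Rightarrow> bool" where
  "polyhedric_at W N K w \<eta> \<longleftrightarrow>
     tangent_cone W N K w \<inter> {h\<in>W. \<eta> h = 0}
       = norm_closure W N (radial_cone K w \<inter> {h\<in>W. \<eta> h = 0})"

definition polyhedric :: "'w::real_vector set \<Rightarrow> ('w \<Rightarrow> real) \<Rightarrow> 'w set \<Rightarrow> bool" where
  "polyhedric W N K \<longleftrightarrow> (\<forall>w\<in>K. \<forall>\<eta>\<in>normal_cone W N K w. polyhedric_at W N K w \<eta>)"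

text \<open>
  Lebesgue spaces are sets of measurable functions. A subspace of a space of equivalence classes
  is a subspace of functions that is closed under modification on null sets.
\<close>

definition L1_space :: "'a measure \<Rightarrow> ('a \<Rightarrow> real) set" where
  "L1_space M = {f. integrable M f}"

definition L2_space :: "'a measure \<Rightarrow> ('a \<Rightarrow> real) set" where
  "L2_space M = {f\<in>borel_measurable M. integrable M (\<lambda>x. (f x)\<^sup>2)}"

definition Linf_space :: "'a measure \<Rightarrow> ('a \<Rightarrow> real) set" where
  "Linf_space M = {f\<in>borel_measurable M. \<exists>C. AE x in M. \<bar>f x\<bar> \<le> C}"

definition L1_norm :: "'a measure \<Rightarrow> ('a \<Rightarrow> real) \<Rightarrow> real" where
  "L1_norm M f = (\<integral>x. \<bar>f x\<bar> \<partial>M)"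

definition L2_inner :: "'a measure \<Rightarrow> ('a \<Rightarrow> real) \<Rightarrow> ('a \<Rightarrow> real) \<Rightarrow> real" where
  "L2_inner M f g = (\<integral>x. f x * g x \<partial>M)"

definition L2_norm :: "'a measure \<Rightarrow> ('a \<Rightarrow> real) \<Rightarrow> real" where
  "L2_norm M f = sqrt (L2_inner M f f)"

definition ae_saturated :: "'a measure \<Rightarrow> ('a \<Rightarrow> real) set \<Rightarrow> bool" where
  "ae_saturated M V \<longleftrightarrow>
     (\<forall>u\<in>V. \<forall>w\<in>borel_measurable M. (AE x in M. u x = w x) \<longrightarrow> w \<in> V)"

definition symmetric_bilinear_on :: "'w::real_vector set \<Rightarrow> ('w \<Rightarrow> 'w \<Rightarrow> real) \<Rightarrow> bool" where
  "symmetric_bilinear_on V E \<longleftrightarrow>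
     (\<forall>u\<in>V. \<forall>v\<in>V. E u v = E v u) \<and> (\<forall>v\<in>V. linear_functional_on V (\<lambda>u. E u v))"

definition E1 :: "'a measure \<Rightarrow> (('a \<Rightarrow> real) \<Rightarrow> ('a \<Rightarrow> real) \<Rightarrow> real)
    \<Rightarrow> ('a \<Rightarrow> real) \<Rightarrow> ('a \<Rightarrow> real) \<Rightarrow> real" where
  "E1 M E u v = E u v + L2_inner M u v"

definition E1_norm :: "'a measure \<Rightarrow> (('a \<Rightarrow> real) \<Rightarrow> ('a \<Rightarrow> real) \<Rightarrow> real)
    \<Rightarrow> ('a \<Rightarrow> real) \<Rightarrow> real" where
  "E1_norm M E u = sqrt (E1 M E u u)"

text \<open>
  The fourth conjunct (respecting almost everywhere equality) says that \<open>E\<close> is a form on equivalence classes. Definiteness of \<open>E1\<close> modulo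
  null functions is automatic from nonnegativity of \<open>E\<close>, so the Hilbert space property amounts to
  completeness.
\<close>

definition dirichlet_space ::
    "'a measure \<Rightarrow> ('a \<Rightarrow> real) set \<Rightarrow> (('a \<Rightarrow> real) \<Rightarrow> ('a \<Rightarrow> real) \<Rightarrow> real) \<Rightarrow> bool" where
  "dirichlet_space M V E \<longleftrightarrow>
     V \<subseteq> L2_space M \<and> subspace V \<and> ae_saturated M V \<and>
     (\<forall>u\<in>V. \<forall>u'\<in>V. \<forall>v\<in>V. (AE x in M. u x = u' x) \<longrightarrow> E u v = E u' v) \<and>
     symmetric_bilinear_on V E \<and>
     (\<forall>f\<in>L2_space M. \<forall>e>0. \<exists>u\<in>V. L2_norm M (f - u) < e) \<and>
     (\<forall>u\<in>V. E u u \<ge> 0) \<and>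
     (\<forall>s. (\<forall>n. s n \<in> V) \<and> (\<forall>e>0. \<exists>n0. \<forall>m\<ge>n0. \<forall>n\<ge>n0. E1_norm M E (s m - s n) < e) \<longrightarrow>
        (\<exists>u\<in>V. (\<lambda>n. E1_norm M E (s n - u)) \<longlonglongrightarrow> 0)) \<and>
     (\<forall>u\<in>V. (\<lambda>x. min 1 (max 0 (u x))) \<in> V \<and>
        E (\<lambda>x. min 1 (max 0 (u x))) (\<lambda>x. min 1 (max 0 (u x))) \<le> E u u)"

definition Cc_space :: "('a::topological_space \<Rightarrow> real) set" where
  "Cc_space = {f. continuous_on UNIV f \<and> compact (closure {x. f x \<noteq> 0})}"

definition regular_dirichlet_space ::
    "'a::metric_space measure \<Rightarrow> ('a \<Rightarrow> real) set
      \<Rightarrow> (('a \<Rightarrow> real) \<Rightarrow> ('a \<Rightarrow> real) \<Rightarrow> real) \<Rightarrow> bool" where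
  "regular_dirichlet_space M V E \<longleftrightarrow>
     dirichlet_space M V E \<and>
     (\<forall>u\<in>V. \<forall>e>0. \<exists>w\<in>V \<inter> Cc_space. E1_norm M E (u - w) < e) \<and>
     (\<forall>f\<in>Cc_space. \<forall>e>0. \<exists>w\<in>V \<inter> Cc_space. (SUP x. \<bar>f x - w x\<bar>) < e)"

definition cap :: "'a::metric_space measure \<Rightarrow> ('a \<Rightarrow> real) set
    \<Rightarrow> (('a \<Rightarrow> real) \<Rightarrow> ('a \<Rightarrow> real) \<Rightarrow> real) \<Rightarrow> 'a set \<Rightarrow> ennreal" where
  "cap M V E A =
     Inf {ennreal (E1 M E u u) | u. u \<in> V \<and>
            (\<exists>U. open U \<and> A \<subseteq> U \<and> (AE x in M. x \<in> U \<longrightarrow> 1 \<le> u x))}"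

definition quasi_continuous :: "'a::metric_space measure \<Rightarrow> ('a \<Rightarrow> real) set
    \<Rightarrow> (('a \<Rightarrow> real) \<Rightarrow> ('a \<Rightarrow> real) \<Rightarrow> real) \<Rightarrow> ('a \<Rightarrow> real) \<Rightarrow> bool" where
  "quasi_continuous M V E u \<longleftrightarrow>
     (\<forall>\<epsilon>>0. \<exists>G. open G \<and> cap M V E G < ennreal \<epsilon> \<and> continuous_on (- G) u)"

definition dual_embedding :: "'a measure \<Rightarrow> ('a \<Rightarrow> real) set \<Rightarrow> ('a \<Rightarrow> real)
    \<Rightarrow> ('a \<Rightarrow> real) \<Rightarrow> real" where
  "dual_embedding M V v = (\<lambda>u. if u \<in> V then (\<integral>x. v x * u x \<partial>M) else 0)"

definition unit_box :: "'a measure \<Rightarrow> ('a \<Rightarrow> real) set" where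
  "unit_box M = {v\<in>Linf_space M. AE x in M. -1 \<le> v x \<and> v x \<le> 1}"

end

theory Submission
  imports Defs
begin

text \<open>
  Choose a compact null set \<open>K\<close> of positive capacity and \<open>y\<close>, \<open>U\<close> with \<open>K = U \<inter> {y = 0}\<close> up to
  capacity zero, and put \<open>z = min 1 \<bar>y\<bar>\<close>. At the constant function 1 the tangent cone of the box is
  the closure of the nonpositive bounded functions, hence it contains minus the capacitary measure
  \<open>\<nu>\<close> of (a compact part of) \<open>K\<close>, and \<open>\<nu>(z) = 0\<close> because \<open>z\<close> vanishes quasi-everywhere on \<open>K\<close>.
  A radial direction annihilated by \<open>z\<close>, however, is a bounded function that vanishes almost
  everywhere on \<open>{y \<noteq> 0}\<close>, hence on \<open>U\<close>, since \<open>K\<close> is a null set. So all elements of the closure of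
  these directions vanish on test functions supported in \<open>U\<close>, and \<open>-\<nu>\<close> does not. The measure \<open>\<nu>\<close>
  is represented by its potential \<open>f\<close>, as the functional \<open>u \<mapsto> E1 f u\<close>.
\<close>

section \<open>Semi-Hilbert spaces\<close>

text \<open>The zero set hypothesis concerns compact sets, whereas the given null set is merely
  Borel; this is why capacitability enters. Enlarging the null set to a null G-delta set first makes
  the compact set that is found inside it null again. The identity of \<open>K\<close> with
  \<open>U \<inter> {y = 0}\<close> holds only up to capacity zero, so \<open>K\<close> may stick
  out of \<open>U\<close>; a compact part \<open>L\<close> inside \<open>U\<close> still has
  positive capacity and leaves room for a test function \<open>\<phi>\<close> of \<open>V\<close>
  that is at least 1 near \<open>L\<close> and vanishes off \<open>U\<close>. The measure
  \<open>\<nu>\<close> is never built as a measure: all that is used of \<open>B f\<close> is that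
  it is nonnegative on nonnegative functions, zero on functions vanishing near \<open>L\<close>, and
  positive at \<open>\<phi>\<close>. The delicate point is then \<open>B f z = 0\<close>, since
  \<open>z\<close> vanishes on \<open>L\<close> only quasi-everywhere and not on a neighborhood.
  Arguments by weak compactness are replaced throughout by strongly convergent sequences chosen from
  convex sets with the parallelogram identity.\<close>

lemma linear_functional_on_diff:
  assumes "linear_functional_on W \<phi>" "u \<in> W" "v \<in> W" "subspace W"
  shows "\<phi> (u - v) = \<phi> u - \<phi> v"
proof -
  have "- v \<in> W" using assms subspace_neg by blast
  then have "\<phi> (u + (- v)) = \<phi> u + \<phi> (- v)" 
    using assms unfolding linear_functional_on_def by blast
  moreover have "\<phi> ((-1) *\<^sub>R v) = (-1) * \<phi> v"
    using assms unfolding linear_functional_on_def by blast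
  ultimately show ?thesis by simp
qed

lemma zero_functional: "linear_functional_on W (\<lambda>_. 0)"
  by (simp add: linear_functional_on_def)

text \<open>\<open>B\<close> is only semidefinite because elements of \<open>V\<close> are
  functions, and almost everywhere equal functions have distance zero. Limits are therefore
  determined only up to such functions.\<close>

locale semi_hilbert =
  fixes V :: "'w::real_vector set" and B :: "'w \<Rightarrow> 'w \<Rightarrow> real"
  assumes sub: "subspace V"
    and bil: "symmetric_bilinear_on V B"
    and nonneg: "u \<in> V \<Longrightarrow> B u u \<ge> 0"
    and complete: "(\<And>n. s n \<in> V) \<Longrightarrow>
        (\<And>e. e > 0 \<Longrightarrow> \<exists>n0. \<forall>m\<ge>n0. \<forall>n\<ge>n0. sqrt (B (s m - s n) (s m - s n)) < e) \<Longrightarrow>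
        \<exists>u\<in>V. (\<lambda>n. sqrt (B (s n - u) (s n - u))) \<longlonglongrightarrow> 0"
begin

definition nrm :: "'w \<Rightarrow> real" where "nrm u = sqrt (B u u)"

lemmas mem_add = subspace_add[OF sub]
  and mem_diff = subspace_diff[OF sub]
  and mem_scale = subspace_scale[OF sub]
  and mem_neg = subspace_neg[OF sub]
  and mem_zero = subspace_0[OF sub]

lemmas mem = mem_add mem_diff mem_scale mem_neg mem_zero

lemma commute: "u \<in> V \<Longrightarrow> v \<in> V \<Longrightarrow> B u v = B v u"
  using bil unfolding symmetric_bilinear_on_def by blast

lemma linear_left: "v \<in> V \<Longrightarrow> linear_functional_on V (\<lambda>u. B u v)"
  using bil unfolding symmetric_bilinear_on_def by blast

lemma expand:
  assumes "u \<in> V" "v \<in> V" "w \<in> V"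
  shows "B (u + v) w = B u w + B v w" "B (c *\<^sub>R u) w = c * B u w" "B (u - v) w = B u w - B v w"
    "B w (u + v) = B w u + B w v" "B w (c *\<^sub>R u) = c * B w u" "B w (u - v) = B w u - B w v"
proof -
  show 1: "B (u + v) w = B u w + B v w" "B (c *\<^sub>R u) w = c * B u w"
    using linear_left[OF assms(3)] assms unfolding linear_functional_on_def by blast+
  show 2: "B (u - v) w = B u w - B v w"
    using linear_functional_on_diff[OF linear_left[OF assms(3)] assms(1,2) sub] .
  show "B w (u + v) = B w u + B w v" "B w (c *\<^sub>R u) = c * B w u" "B w (u - v) = B w u - B w v"
    using 1 2 assms commute[of w] by (simp_all add: mem)
qed

lemma linear_right: "v \<in> V \<Longrightarrow> linear_functional_on V (B v)"
  unfolding linear_functional_on_def using expand by simp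

lemma expand_line:
  assumes "u \<in> V" "v \<in> V"
  shows "B (u + t *\<^sub>R v) (u + t *\<^sub>R v) = B u u + 2 * t * B u v + t\<^sup>2 * B v v"
proof -
  show ?thesis
    using assms commute[OF assms] by (simp add: mem expand power2_eq_square algebra_simps)
qed

lemma nrm_nonneg: "u \<in> V \<Longrightarrow> nrm u \<ge> 0"
  unfolding nrm_def using nonneg by simp

lemma nrm_square: "u \<in> V \<Longrightarrow> (nrm u)\<^sup>2 = B u u"
  unfolding nrm_def using nonneg by simp

lemma cauchy_schwarz:
  assumes "u \<in> V" "v \<in> V"
  shows "\<bar>B u v\<bar> \<le> nrm u * nrm v"
proof -
  have q: "0 \<le> B u u + 2 * t * B u v + t\<^sup>2 * B v v" for t
    using nonneg[OF mem_add[OF assms(1) mem_scale[OF assms(2)]]] expand_line[OF assms] by simp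
  have "(B u v)\<^sup>2 \<le> B u u * B v v"
  proof (cases "B v v = 0")
    case True
    show ?thesis
    proof (cases "B u v = 0")
      case False
      \<comment> \<open>If the leading coefficient vanishes, the nonnegative polynomial is affine in
        \<open>t\<close>; with a nonzero slope this \<open>t\<close> would give the value
        -1.\<close>
      have "0 \<le> B u u + 2 * (- (B u u + 1) / (2 * B u v)) * B u v"
        using q[of "- (B u u + 1) / (2 * B u v)"] True by simp
      also have "\<dots> = -1" using False by (simp add: field_simps)
      finally show ?thesis by simp
    qed (use True in simp)
  next
    case False
    then have pos: "B v v > 0" using nonneg[OF assms(2)] by simp
    have "0 \<le> B u u + 2 * (- B u v / B v v) * B u v + (- B u v / B v v)\<^sup>2 * B v v" by (rule q)
    also have "\<dots> = B u u - (B u v)\<^sup>2 / B v v"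
      using False by (simp add: power2_eq_square field_simps)
    finally show ?thesis using pos by (simp add: field_simps)
  qed
  then have "sqrt ((B u v)\<^sup>2) \<le> sqrt (B u u * B v v)" by (rule real_sqrt_le_mono)
  then show ?thesis by (simp add: nrm_def real_sqrt_mult)
qed

lemma nrm_triangle:
  assumes "u \<in> V" "v \<in> V"
  shows "nrm (u + v) \<le> nrm u + nrm v"
proof -
  have "(nrm (u + v))\<^sup>2 = B u u + 2 * B u v + B v v"
    using expand_line[OF assms, of 1] nrm_square[OF mem_add[OF assms]] by simp
  also have "\<dots> \<le> (nrm u)\<^sup>2 + 2 * (nrm u * nrm v) + (nrm v)\<^sup>2"
    using cauchy_schwarz[OF assms] nrm_square assms by simp
  also have "\<dots> = (nrm u + nrm v)\<^sup>2" by (simp add: power2_eq_square algebra_simps)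
  finally show ?thesis
    using nrm_nonneg assms by (meson add_nonneg_nonneg power2_le_imp_le)
qed

lemma nrm_scale: "u \<in> V \<Longrightarrow> nrm (c *\<^sub>R u) = \<bar>c\<bar> * nrm u"
  unfolding nrm_def using expand(2,5)[of u u] mem_scale[of u]
  by (simp add: real_sqrt_mult flip: mult.assoc power2_eq_square)

lemma nrm_minus: "u \<in> V \<Longrightarrow> nrm (- u) = nrm u"
  using nrm_scale[of u "-1"] by simp

lemma nrm_triangle_diff:
  assumes "u \<in> V" "v \<in> V"
  shows "nrm (u - v) \<le> nrm u + nrm v"
  using nrm_triangle[OF assms(1) mem_neg[OF assms(2)]] nrm_minus[OF assms(2)] by simp

section \<open>Limits in the seminorm and minimization over convex sets\<close>

lemma functional_tendsto:
  assumes "linear_functional_on V \<phi>" "\<And>u. u \<in> V \<Longrightarrow> \<bar>\<phi> u\<bar> \<le> C * nrm u"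
    and "\<And>n. s n \<in> V" "u \<in> V" "(\<lambda>n. nrm (s n - u)) \<longlonglongrightarrow> 0"
  shows "(\<lambda>n. \<phi> (s n)) \<longlonglongrightarrow> \<phi> u"
proof -
  have "(\<lambda>n. C * nrm (s n - u)) \<longlonglongrightarrow> 0" using tendsto_mult_right_zero[OF assms(5)] .
  moreover have "\<bar>\<phi> (s n) - \<phi> u\<bar> \<le> C * nrm (s n - u)" for n
    using assms(2)[OF mem_diff[OF assms(3)[of n] assms(4)]]
      linear_functional_on_diff[OF assms(1) assms(3)[of n] assms(4) sub] by simp
  ultimately have "(\<lambda>n. \<phi> (s n) - \<phi> u) \<longlonglongrightarrow> 0"
    by (intro Lim_null_comparison[of "\<lambda>n. \<phi> (s n) - \<phi> u"]) auto
  then show ?thesis using LIM_zero_iff by blast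
qed

lemma right_tendsto:
  assumes "v \<in> V" "\<And>n. s n \<in> V" "u \<in> V" "(\<lambda>n. nrm (s n - u)) \<longlonglongrightarrow> 0"
  shows "(\<lambda>n. B v (s n)) \<longlonglongrightarrow> B v u"
  using functional_tendsto[OF linear_right[OF assms(1)] cauchy_schwarz[OF assms(1)]] assms(2-) by blast

lemma diagonal_tendsto:
  assumes "\<And>n. s n \<in> V" "u \<in> V" "(\<lambda>n. nrm (s n - u)) \<longlonglongrightarrow> 0"
  shows "(\<lambda>n. B (s n) (s n)) \<longlonglongrightarrow> B u u"
proof -
  have "B (s n) (s n) = (nrm (s n - u))\<^sup>2 + 2 * B u (s n) - B u u" for n
    using assms mem_diff[OF assms(1)[of n] assms(2)] commute[OF assms(1)[of n] assms(2)]
    by (simp add: nrm_square expand)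
  moreover have "(\<lambda>n. (nrm (s n - u))\<^sup>2 + 2 * B u (s n) - B u u) \<longlonglongrightarrow> 0\<^sup>2 + 2 * B u u - B u u"
    by (intro tendsto_intros assms right_tendsto)
  ultimately show ?thesis by simp
qed

text \<open>If \<open>\<phi>\<close> is represented by \<open>r\<close>, this is
  \<open>B (u - r) (u - r) - B r r\<close>; minimizing it means projecting \<open>r\<close>, before
  \<open>r\<close> is known to exist.\<close>

definition energy :: "('w \<Rightarrow> real) \<Rightarrow> 'w \<Rightarrow> real" where
  "energy \<phi> u = B u u - 2 * \<phi> u"

text \<open>The linear terms cancel at the midpoint, so almost minimal energies of \<open>a\<close>
  and \<open>b\<close> force \<open>a - b\<close> to be small as soon as the midpoint is
  admissible.\<close>

lemma parallelogram:
  assumes "linear_functional_on V \<phi>" "a \<in> V" "b \<in> V"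
  shows "B (a - b) (a - b) = 2 * energy \<phi> a + 2 * energy \<phi> b - 4 * energy \<phi> ((1/2) *\<^sub>R a + (1/2) *\<^sub>R b)"
proof -
  have m: "(1/2) *\<^sub>R a \<in> V" "(1/2) *\<^sub>R b \<in> V" using assms by (auto intro: mem)
  have "\<phi> ((1/2) *\<^sub>R a + (1/2) *\<^sub>R b) = (1/2) * \<phi> a + (1/2) * \<phi> b"
    using assms m unfolding linear_functional_on_def by metis
  moreover have "B ((1/2) *\<^sub>R a + (1/2) *\<^sub>R b) ((1/2) *\<^sub>R a + (1/2) *\<^sub>R b) =
      (B a a + 2 * B a b + B b b) / 4"
    using m mem_add[OF m] commute[OF assms(2,3)] assms(2,3) by (simp add: expand field_simps)
  moreover have "B (a - b) (a - b) = B a a - 2 * B a b + B b b"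
    using mem_diff[OF assms(2,3)] commute[OF assms(2,3)] assms(2,3) by (simp add: expand)
  ultimately show ?thesis by (simp add: energy_def)
qed

text \<open>With \<open>\<phi> = 0\<close> this is the selection of a convergent sequence from shrinking convex sets
  (it replaces weak compactness); with a constant sequence of sets it is the projection theorem.\<close>
lemma convex_minimizing_sequence:
  fixes C :: "nat \<Rightarrow> 'w set"
  assumes \<phi>: "linear_functional_on V \<phi>" "\<And>u. u \<in> V \<Longrightarrow> \<bar>\<phi> u\<bar> \<le> c * nrm u"
    and C: "\<And>n. C n \<subseteq> V" "\<And>n. convex (C n)" "\<And>n. C (Suc n) \<subseteq> C n"
  and bound: "\<And>n. \<exists>g\<in>C n. energy \<phi> g \<le> R"
  shows "\<exists>s v. (\<forall>n. s n \<in> C n) \<and> v \<in> V \<and> (\<lambda>n. nrm (s n - v)) \<longlonglongrightarrow> 0 \<and>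
    (\<forall>x. (\<forall>n. \<exists>g\<in>C n. energy \<phi> g \<le> x) \<longrightarrow> energy \<phi> v \<le> x)"
proof -
  define d where "d n = (INF u\<in>C n. energy \<phi> u)" for n
  \<comment> \<open>Completing the square in \<open>nrm u\<close> bounds the energy from
    below.\<close>
  have low: "- (c\<^sup>2) \<le> energy \<phi> u" if "u \<in> V" for u
  proof -
    have "0 \<le> (nrm u - c)\<^sup>2" by simp
    also have "\<dots> = B u u - 2 * (c * nrm u) + c\<^sup>2"
      using nrm_square[OF that] by (simp add: power2_eq_square algebra_simps)
    also have "\<dots> \<le> energy \<phi> u + c\<^sup>2" using \<phi>(2)[OF that] unfolding energy_def by simp
    finally show ?thesis by simp
  qed
  have bdd: "bdd_below (energy \<phi> ` C n)" for n
    using low C(1)[of n] by (intro bdd_belowI[of _ "- (c\<^sup>2)"]) auto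
  have ne: "C n \<noteq> {}" for n using bound[of n] by auto
  have d_le: "d n \<le> energy \<phi> u" if "u \<in> C n" for n u
    unfolding d_def using cINF_lower[OF bdd that] .
  have d_le': "d n \<le> x" if ex: "\<exists>g\<in>C n. energy \<phi> g \<le> x" for n x
  proof -
    obtain g where "g \<in> C n" "energy \<phi> g \<le> x" using ex by blast
    then show ?thesis using d_le[of g n] by linarith
  qed
  have "d n \<le> d (Suc n)" for n
    unfolding d_def using cINF_superset_mono[OF ne bdd C(3)] by blast
  then have inc: "incseq d" by (rule incseq_SucI)
  have dR: "d n \<le> R" for n by (rule d_le'[OF bound])
  obtain L where "d \<longlonglongrightarrow> L" "\<forall>n. d n \<le> L"
    by (rule incseq_convergent[OF inc]) (use dR in auto)
  then have L: "d \<longlonglongrightarrow> L" "\<And>n. d n \<le> L" by auto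
  have "\<exists>u. u \<in> C n \<and> energy \<phi> u < d n + 1 / Suc n" for n
  proof -
    have "Inf (energy \<phi> ` C n) < d n + 1 / Suc n" unfolding d_def by simp
    then have "\<exists>x\<in>energy \<phi> ` C n. x < d n + 1 / Suc n" using ne by (intro cInf_lessD) auto
    then show ?thesis by (elim bexE imageE) blast
  qed
  then have "\<exists>s. \<forall>n. s n \<in> C n \<and> energy \<phi> (s n) < d n + 1 / Suc n" by (rule choice[OF allI])
  then obtain s where s: "\<And>n. s n \<in> C n" "\<And>n. energy \<phi> (s n) < d n + 1 / Suc n" by blast
  have sV: "s n \<in> V" for n using s C(1) by blast
  have Cdec: "C n \<subseteq> C m" if "m \<le> n" for m n
    using lift_Suc_antimono_le[of C, OF C(3) that] .
  \<comment> \<open>Both points and their midpoint lie in \<open>C k\<close>. The midpoint has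
    energy at least \<open>d k\<close>, the two points at most \<open>L + 1 / Suc k\<close>.\<close>
  have est: "B (s m - s n) (s m - s n) \<le> 4 * (L - d k) + 4 / Suc k" if "k \<le> m" "k \<le> n" for m n k
  proof -
    have "s m \<in> C k" "s n \<in> C k" using s Cdec that by blast+
    then have "(1/2) *\<^sub>R s m + (1/2) *\<^sub>R s n \<in> C k"
      using C(2)[of k] by (intro convexD) auto
    then have "d k \<le> energy \<phi> ((1/2) *\<^sub>R s m + (1/2) *\<^sub>R s n)" by (rule d_le)
    moreover have "energy \<phi> (s m) \<le> L + 1 / Suc k" 
      using s(2)[of m] L(2)[of m] that(1) frac_le[of 1 1 "Suc k" "Suc m"] by simp
    moreover have "energy \<phi> (s n) \<le> L + 1 / Suc k" 
      using s(2)[of n] L(2)[of n] that(2) frac_le[of 1 1 "Suc k" "Suc n"] by simp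
    ultimately show ?thesis
      using parallelogram[OF \<phi>(1) sV sV, of m n] unfolding energy_def by simp
  qed
  have lim0: "(\<lambda>k. 4 * (L - d k) + 4 / Suc k) \<longlonglongrightarrow> 0"
  proof -
    have "(\<lambda>k. 4 * (L - d k) + 4 * inverse (real (Suc k))) \<longlonglongrightarrow> 4 * (L - L) + 4 * 0"
      by (intro tendsto_intros L LIMSEQ_inverse_real_of_nat)
    then show ?thesis by (simp add: divide_inverse)
  qed
  have "\<exists>n0. \<forall>m\<ge>n0. \<forall>n\<ge>n0. sqrt (B (s m - s n) (s m - s n)) < e" if "e > 0" for e
  proof -
    have "\<forall>\<^sub>F k in sequentially. 4 * (L - d k) + 4 / Suc k < e\<^sup>2"
      using order_tendstoD(2)[OF lim0, of "e\<^sup>2"] that by simp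
    then obtain k where k: "4 * (L - d k) + 4 / Suc k < e\<^sup>2"
      using eventually_happens[of _ sequentially] by auto
    have "sqrt (B (s m - s n) (s m - s n)) < e" if mn: "k \<le> m" "k \<le> n" for m n
    proof -
      have "B (s m - s n) (s m - s n) < e\<^sup>2" using est[OF mn] k by linarith
      then have "sqrt (B (s m - s n) (s m - s n)) < sqrt (e\<^sup>2)" by (rule real_sqrt_less_mono)
      then show ?thesis using \<open>e > 0\<close> by simp
    qed
    then show ?thesis by blast
  qed
  then have "\<exists>u\<in>V. (\<lambda>n. sqrt (B (s n - u) (s n - u))) \<longlonglongrightarrow> 0"
    by (intro complete sV)
  then obtain v where v: "v \<in> V" "(\<lambda>n. nrm (s n - v)) \<longlonglongrightarrow> 0"
    unfolding nrm_def by blast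
  \<comment> \<open>The sets \<open>C n\<close> need not be closed, so \<open>v\<close> may belong
    to none of them; what survives is the bound on its energy.\<close>
  have "energy \<phi> v \<le> x" if x: "\<And>n. \<exists>g\<in>C n. energy \<phi> g \<le> x" for x
  proof -
    have "(\<lambda>n. energy \<phi> (s n)) \<longlonglongrightarrow> energy \<phi> v"
      unfolding energy_def by (intro tendsto_intros diagonal_tendsto functional_tendsto[OF \<phi>] sV v)
    moreover have "(\<lambda>n. x + inverse (real (Suc n))) \<longlonglongrightarrow> x + 0"
      by (intro tendsto_intros LIMSEQ_inverse_real_of_nat)
    moreover have "energy \<phi> (s n) \<le> x + inverse (real (Suc n))" for n
      using s(2)[of n] d_le'[OF x, of n] by (simp add: divide_inverse)
    ultimately have "energy \<phi> v \<le> x + 0" by (meson LIMSEQ_le)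
    then show ?thesis by simp
  qed
  then show ?thesis using s(1) v by blast
qed

lemma convex_norm_selection:
  fixes C :: "nat \<Rightarrow> 'w set"
  assumes C: "\<And>n. C n \<subseteq> V" "\<And>n. convex (C n)" "\<And>n. C (Suc n) \<subseteq> C n"
    and bound: "\<And>n. \<exists>g\<in>C n. B g g \<le> R"
  shows "\<exists>s v. (\<forall>n. s n \<in> C n) \<and> v \<in> V \<and> (\<lambda>n. nrm (s n - v)) \<longlonglongrightarrow> 0 \<and> B v v \<le> R"
proof -
  have "\<exists>g\<in>C n. energy (\<lambda>_. 0) g \<le> R" for n using bound by (simp add: energy_def)
  moreover have "\<And>u. u \<in> V \<Longrightarrow> \<bar>0::real\<bar> \<le> 0 * nrm u" by simp
  ultimately have "\<exists>s v. (\<forall>n. s n \<in> C n) \<and> v \<in> V \<and> (\<lambda>n. nrm (s n - v)) \<longlonglongrightarrow> 0 \<and>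
    (\<forall>x. (\<forall>n. \<exists>g\<in>C n. energy (\<lambda>_. 0) g \<le> x) \<longrightarrow> energy (\<lambda>_. 0) v \<le> x)"
    by (intro convex_minimizing_sequence[where \<phi> = "\<lambda>_. 0" and c = 0 and R = R] zero_functional C) auto
  then show ?thesis using bound by (simp add: energy_def) blast
qed

text \<open>First order condition for the minimizer of \<open>energy\<close>: its derivative in the
  direction \<open>x - v\<close> is nonnegative. As \<open>S\<close> need not be closed,
  \<open>v\<close> comes with an approximating sequence in place of membership in
  \<open>S\<close>.\<close>

lemma variational_inequality:
  assumes \<phi>: "linear_functional_on V \<phi>" "\<And>u. u \<in> V \<Longrightarrow> \<bar>\<phi> u\<bar> \<le> c * nrm u"
    and S: "S \<subseteq> V" "convex S" "S \<noteq> {}"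
  shows "\<exists>s v. (\<forall>n::nat. s n \<in> S) \<and> v \<in> V \<and> (\<lambda>n. nrm (s n - v)) \<longlonglongrightarrow> 0 \<and>
    (\<forall>x\<in>S. \<phi> (x - v) \<le> B v (x - v))"
proof -
  obtain g where g: "g \<in> S" using S by blast
  have "\<exists>s v. (\<forall>n::nat. s n \<in> S) \<and> v \<in> V \<and> (\<lambda>n. nrm (s n - v)) \<longlonglongrightarrow> 0 \<and>
      (\<forall>x. (\<forall>n::nat. \<exists>g\<in>S. energy \<phi> g \<le> x) \<longrightarrow> energy \<phi> v \<le> x)"
    by (rule convex_minimizing_sequence[OF \<phi>, where R = "energy \<phi> g"]) (use S g in auto)
  then obtain s v where sv: "(\<forall>n::nat. s n \<in> S) \<and> v \<in> V \<and> (\<lambda>n. nrm (s n - v)) \<longlonglongrightarrow> 0 \<and>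
      (\<forall>x. (\<forall>n::nat. \<exists>g\<in>S. energy \<phi> g \<le> x) \<longrightarrow> energy \<phi> v \<le> x)"
    by (elim exE) (rule that)
  then have s: "\<And>n. s n \<in> S" "v \<in> V" "(\<lambda>n. nrm (s n - v)) \<longlonglongrightarrow> 0" by simp_all
  have min: "energy \<phi> v \<le> energy \<phi> g" if "g \<in> S" for g using sv that by blast
  have sV: "s n \<in> V" for n using s S by blast
  have "\<phi> (x - v) \<le> B v (x - v)" if x: "x \<in> S" for x
  proof -
    have xV: "x \<in> V" using x S by blast
    have step: "0 \<le> 2 * (B v (x - v) - \<phi> (x - v)) + t * B (x - v) (x - v)" if t: "0 < t" "t < 1" for t
    proof -
      \<comment> \<open>The segment from \<open>v\<close> to \<open>x\<close> may leave
        \<open>S\<close>, so minimality is tested at the points \<open>q n\<close> of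
        \<open>S\<close> and carried over to \<open>q'\<close> in the limit.\<close>
      define q where "q n = (1 - t) *\<^sub>R s n + t *\<^sub>R x" for n
      define q' where "q' = (1 - t) *\<^sub>R v + t *\<^sub>R x"
      have qS: "q n \<in> S" for n unfolding q_def using t s x by (intro convexD[OF S(2)]) auto
      then have qV: "q n \<in> V" for n using S by blast
      have q'V: "q' \<in> V" unfolding q'_def by (intro mem xV s(2))
      have "q n - q' = (1 - t) *\<^sub>R (s n - v)" for n
        unfolding q_def q'_def by (simp add: algebra_simps)
      then have "nrm (q n - q') = \<bar>1 - t\<bar> * nrm (s n - v)" for n
        using nrm_scale[OF mem_diff[OF sV s(2)]] by simp
      then have lim: "(\<lambda>n. nrm (q n - q')) \<longlonglongrightarrow> 0"
        using tendsto_mult_right_zero[OF s(3)] by simp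
      have "(\<lambda>n. energy \<phi> (q n)) \<longlonglongrightarrow> energy \<phi> q'"
        unfolding energy_def by (intro tendsto_intros diagonal_tendsto functional_tendsto[OF \<phi>] qV q'V lim)
      moreover have "energy \<phi> v \<le> energy \<phi> (q n)" for n using min qS by blast
      ultimately have le: "energy \<phi> v \<le> energy \<phi> q'" by (meson LIMSEQ_le_const)
      have q'eq: "q' = v + t *\<^sub>R (x - v)" unfolding q'_def by (simp add: algebra_simps)
      have xv: "x - v \<in> V" by (intro mem xV s(2))
      have "\<phi> q' = \<phi> v + t * \<phi> (x - v)"
      proof -
        have "\<phi> (v + t *\<^sub>R (x - v)) = \<phi> v + \<phi> (t *\<^sub>R (x - v))" "\<phi> (t *\<^sub>R (x - v)) = t * \<phi> (x - v)"
          using \<phi>(1) xv s(2) mem_scale[OF xv, of t] unfolding linear_functional_on_def by blast+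
        then show ?thesis unfolding q'eq by simp
      qed
      then have "energy \<phi> q' = energy \<phi> v + t * (2 * (B v (x - v) - \<phi> (x - v)) + t * B (x - v) (x - v))"
        unfolding energy_def q'eq using expand_line[OF s(2) xv, of t]
        by (simp add: algebra_simps power2_eq_square)
      then have "0 \<le> t * (2 * (B v (x - v) - \<phi> (x - v)) + t * B (x - v) (x - v))" using le by simp
      then show ?thesis using t by (simp add: zero_le_mult_iff)
    qed
    have "((\<lambda>t. 2 * (B v (x - v) - \<phi> (x - v)) + t * B (x - v) (x - v)) \<longlongrightarrow>
        2 * (B v (x - v) - \<phi> (x - v)) + 0 * B (x - v) (x - v)) (at_right 0)"
      by (intro tendsto_intros)
    moreover have "\<forall>\<^sub>F t in at_right 0. 0 \<le> 2 * (B v (x - v) - \<phi> (x - v)) + t * B (x - v) (x - v)"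
      using step by (auto simp: eventually_at_right_field intro!: exI[of _ 1])
    ultimately have "0 \<le> 2 * (B v (x - v) - \<phi> (x - v)) + 0 * B (x - v) (x - v)"
      by (rule tendsto_lowerbound[OF _ _ trivial_limit_at_right_real])
    then show ?thesis by simp
  qed
  then show ?thesis
    by (intro exI[of _ s] exI[of _ v] conjI allI ballI s)
qed

lemma subspace_nonempty: "V \<noteq> {}"
  using sub subspace_0 by blast

lemma riesz:
  assumes \<phi>: "linear_functional_on V \<phi>" "\<And>u. u \<in> V \<Longrightarrow> \<bar>\<phi> u\<bar> \<le> c * nrm u"
  obtains v where "v \<in> V" "\<And>u. u \<in> V \<Longrightarrow> B v u = \<phi> u"
proof -
  have cvx: "convex V" using sub by (simp add: subspace_imp_convex)
  obtain v where v: "v \<in> V" and ineq: "\<And>x. x \<in> V \<Longrightarrow> \<phi> (x - v) \<le> B v (x - v)"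
    using variational_inequality[OF \<phi> order.refl cvx subspace_nonempty] by blast
  have "B v u = \<phi> u" if u: "u \<in> V" for u
  proof -
    \<comment> \<open>On a subspace both \<open>v + u\<close> and \<open>v - u\<close> are
      admissible, which turns the inequality into an equality.\<close>
    have "\<phi> u \<le> B v u" using ineq[OF mem_add[OF u v]] by simp
    moreover have "\<phi> ((-1) *\<^sub>R u) = (-1) * \<phi> u"
      using \<phi>(1) u unfolding linear_functional_on_def by blast
    then have "- \<phi> u \<le> - B v u"
      using ineq[OF mem_diff[OF v u]] expand(5)[OF u u v, of "-1"] by simp
    ultimately show ?thesis by simp
  qed
  then show thesis using that[OF v] by simp
qed

end

section \<open>Truncations in a Dirichlet space\<close>

text \<open>For \<open>w\<close> with values in [-1, 1], \<open>trunc 1 w\<close> and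
  \<open>trunc 1 (- w)\<close> are the positive and negative parts, so lattice operations can be
  derived from the Markov property. Arbitrary levels \<open>c\<close> serve to cut off small
  values.\<close>

definition trunc :: "real \<Rightarrow> ('a \<Rightarrow> real) \<Rightarrow> 'a \<Rightarrow> real" where
  "trunc c u = (\<lambda>x. min c (max 0 (u x)))"

locale dirichlet =
  fixes \<mu> :: "'a::metric_space measure"
    and V :: "('a \<Rightarrow> real) set"
    and E :: "('a \<Rightarrow> real) \<Rightarrow> ('a \<Rightarrow> real) \<Rightarrow> real"
  assumes dirichlet: "dirichlet_space \<mu> V E"
    and borel: "sets \<mu> = sets borel"
begin

abbreviation B :: "('a \<Rightarrow> real) \<Rightarrow> ('a \<Rightarrow> real) \<Rightarrow> real" where "B \<equiv> E1 \<mu> E"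

lemma measurable_V: "u \<in> V \<Longrightarrow> u \<in> borel_measurable \<mu>"
  and integrable_square: "u \<in> V \<Longrightarrow> integrable \<mu> (\<lambda>x. (u x)\<^sup>2)"
  using dirichlet unfolding dirichlet_space_def L2_space_def by blast+

lemma subspace_V: "subspace V"
  and form: "symmetric_bilinear_on V E"
  and form_nonneg: "u \<in> V \<Longrightarrow> E u u \<ge> 0"
  and markov: "u \<in> V \<Longrightarrow> trunc 1 u \<in> V"
    "u \<in> V \<Longrightarrow> E (trunc 1 u) (trunc 1 u) \<le> E u u"
  using dirichlet unfolding dirichlet_space_def trunc_def by blast+

lemma form_cong_AE: "u \<in> V \<Longrightarrow> u' \<in> V \<Longrightarrow> v \<in> V \<Longrightarrow> AE x in \<mu>. u x = u' x \<Longrightarrow> E u v = E u' v"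
  using dirichlet unfolding dirichlet_space_def by blast

lemma integrable_mult:
  assumes "u \<in> V" "v \<in> V"
  shows "integrable \<mu> (\<lambda>x. u x * v x)"
proof (rule Bochner_Integration.integrable_bound)
  show "integrable \<mu> (\<lambda>x. (u x)\<^sup>2 + (v x)\<^sup>2)" using integrable_square assms by auto
  show "(\<lambda>x. u x * v x) \<in> borel_measurable \<mu>" using measurable_V assms by auto
  have "\<bar>a * b\<bar> \<le> a\<^sup>2 + b\<^sup>2" for a b :: real
  proof -
    have "0 \<le> (\<bar>a\<bar> - \<bar>b\<bar>)\<^sup>2" by simp
    then have "2 * \<bar>a * b\<bar> \<le> a\<^sup>2 + b\<^sup>2" by (simp add: power2_eq_square algebra_simps abs_mult)
    then show ?thesis by simp
  qed
  then show "AE x in \<mu>. norm (u x * v x) \<le> norm ((u x)\<^sup>2 + (v x)\<^sup>2)" by simp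
qed

lemma L2_bilinear: "symmetric_bilinear_on V (L2_inner \<mu>)"
  unfolding symmetric_bilinear_on_def linear_functional_on_def L2_inner_def
  using integrable_mult by (auto simp: mult.commute scaleR_fun_def distrib_left algebra_simps simp flip: Bochner_Integration.integral_add)

lemma L2_nonneg: "L2_inner \<mu> u u \<ge> 0"
  unfolding L2_inner_def by (auto intro: Bochner_Integration.integral_nonneg)

sublocale semi_hilbert V B
proof
  show "subspace V" by (rule subspace_V)
  show "symmetric_bilinear_on V B"
    using form L2_bilinear unfolding symmetric_bilinear_on_def linear_functional_on_def E1_def
    by (auto simp: algebra_simps)
  show "B u u \<ge> 0" if "u \<in> V" for u
    using form_nonneg[OF that] L2_nonneg by (simp add: E1_def)
  have compl: "\<forall>s. (\<forall>n. s n \<in> V) \<and> (\<forall>e>0. \<exists>n0. \<forall>m\<ge>n0. \<forall>n\<ge>n0. E1_norm \<mu> E (s m - s n) < e) \<longrightarrow>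
        (\<exists>u\<in>V. (\<lambda>n. E1_norm \<mu> E (s n - u)) \<longlonglongrightarrow> 0)"
    using dirichlet unfolding dirichlet_space_def by blast
  show "\<exists>u\<in>V. (\<lambda>n. sqrt (B (s n - u) (s n - u))) \<longlonglongrightarrow> 0"
    if "\<And>n. s n \<in> V"
      "\<And>e. e > 0 \<Longrightarrow> \<exists>n0. \<forall>m\<ge>n0. \<forall>n\<ge>n0. sqrt (B (s m - s n) (s m - s n)) < e" for s
    using compl[unfolded E1_norm_def, rule_format, of s] that by blast
qed

lemma E1_norm_eq: "E1_norm \<mu> E = nrm"
  by (simp add: fun_eq_iff E1_norm_def nrm_def)

lemma L2_le: "u \<in> V \<Longrightarrow> (\<integral>x. (u x)\<^sup>2 \<partial>\<mu>) \<le> B u u"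
  using form_nonneg[of u] by (simp add: E1_def L2_inner_def power2_eq_square)


lemma B_cong_AE:
  assumes "u \<in> V" "u' \<in> V" "v \<in> V" "AE x in \<mu>. u x = u' x"
  shows "B u v = B u' v"
proof -
  have "(\<integral>x. u x * v x \<partial>\<mu>) = (\<integral>x. u' x * v x \<partial>\<mu>)"
    using assms measurable_V by (intro integral_cong_AE) (auto elim: eventually_mono)
  then show ?thesis using form_cong_AE[OF assms] by (simp add: E1_def L2_inner_def)
qed

lemma null_B:
  assumes "v \<in> V" "AE x in \<mu>. v x = 0"
  shows "nrm v = 0"
proof -
  have "B v v = B 0 v" using assms mem_zero by (intro B_cong_AE) (auto simp: zero_fun_def)
  also have "\<dots> = 0" using expand(2)[OF mem_zero mem_zero assms(1), of 0] by simp
  finally show ?thesis by (simp add: nrm_def)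
qed

lemma trunc_scale: "c > 0 \<Longrightarrow> trunc c u = c *\<^sub>R trunc 1 ((1/c) *\<^sub>R u)"
  by (auto simp: trunc_def scaleR_fun_def fun_eq_iff min_def max_def field_simps)

lemma trunc_mem: "u \<in> V \<Longrightarrow> c > 0 \<Longrightarrow> trunc c u \<in> V"
  unfolding trunc_scale by (intro mem markov)

lemma trunc_1_contract: 
  assumes "u \<in> V"
  shows "B (trunc 1 u) (trunc 1 u) \<le> B u u"
proof -
  have "(min 1 (max 0 a))\<^sup>2 \<le> a\<^sup>2" for a :: real
    by (rule abs_le_square_iff[THEN iffD1]) auto
  then have "(\<integral>x. (trunc 1 u x)\<^sup>2 \<partial>\<mu>) \<le> (\<integral>x. (u x)\<^sup>2 \<partial>\<mu>)"
    using integrable_square[OF markov(1)[OF assms]] integrable_square[OF assms]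
    by (intro integral_mono) (auto simp: trunc_def)
  then show ?thesis
    using markov(2)[OF assms] by (simp add: E1_def L2_inner_def power2_eq_square)
qed

lemma trunc_contract:
  assumes "u \<in> V" "c > 0"
  shows "B (trunc c u) (trunc c u) \<le> B u u"
proof -
  have v: "(1/c) *\<^sub>R u \<in> V" using assms(1,2) by (auto intro: mem)
  have "B (trunc c u) (trunc c u) = c\<^sup>2 * B (trunc 1 ((1/c) *\<^sub>R u)) (trunc 1 ((1/c) *\<^sub>R u))"
    unfolding trunc_scale[OF assms(2)] using markov(1)[OF v]
    by (simp add: expand mem power2_eq_square)
  also have "\<dots> \<le> c\<^sup>2 * B ((1/c) *\<^sub>R u) ((1/c) *\<^sub>R u)"
    using trunc_1_contract[OF v] by (intro mult_left_mono) auto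
  also have "\<dots> = B u u" using assms by (simp add: expand mem power2_eq_square)
  finally show ?thesis .
qed

text \<open>The Markov property applied to \<open>w\<^sup>+ - t w\<^sup>-\<close>, whose truncation is \<open>w\<^sup>+\<close>, yields the claim
  as \<open>t\<close> tends to 0.\<close>
lemma pos_neg_part:
  assumes "w \<in> V" "\<And>x. \<bar>w x\<bar> \<le> 1"
  shows "B (trunc 1 w) (trunc 1 (- w)) \<le> 0"
proof -
  define p n where "p = trunc 1 w" and "n = trunc 1 (- w)"
  have V: "p \<in> V" "n \<in> V" using assms markov mem unfolding p_def n_def by auto
  have le: "2 * B p n \<le> t * B n n" if t: "0 < t" for t
  proof -
    have "trunc 1 (p + (-t) *\<^sub>R n) = p"
    proof
      fix x
      have "w x \<ge> 0 \<Longrightarrow> n x = 0" "w x \<le> 0 \<Longrightarrow> p x = 0" "n x \<ge> 0" "0 \<le> p x" "p x \<le> 1"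
        unfolding p_def n_def trunc_def by auto
      then show "trunc 1 (p + (-t) *\<^sub>R n) x = p x"
        using t mult_nonneg_nonneg[of t "n x"]
        by (cases "w x \<ge> 0") (auto simp: trunc_def scaleR_fun_def)
    qed
    then have "B p p \<le> B (p + (-t) *\<^sub>R n) (p + (-t) *\<^sub>R n)"
      using trunc_1_contract[OF mem_add[OF V(1) mem_scale[OF V(2)]]] by metis
    also have "\<dots> = B p p + t * (t * B n n - 2 * B p n)"
      unfolding expand_line[OF V] by (simp add: power2_eq_square algebra_simps)
    finally have "0 \<le> t * (t * B n n - 2 * B p n)" by simp
    then show ?thesis using t by (simp add: zero_le_mult_iff)
  qed
  have "((\<lambda>t. t * B n n) \<longlongrightarrow> 0 * B n n) (at_right 0)" by (intro tendsto_intros)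
  moreover have "\<forall>\<^sub>F t in at_right 0. 2 * B p n \<le> t * B n n"
    using le by (auto simp: eventually_at_right_field intro!: exI[of _ 1])
  ultimately have "2 * B p n \<le> 0 * B n n"
    by (rule tendsto_lowerbound[OF _ _ trivial_limit_at_right_real])
  then show ?thesis unfolding p_def n_def by simp
qed

text \<open>With \<open>p\<close> the positive part of \<open>w = u - v\<close>, the maximum is
  \<open>v + p\<close> and the minimum is \<open>u - p\<close>. Expanding, the two sides differ by
  \<open>2 * B p (p - w)\<close>, where \<open>p - w\<close> is the negative part of
  \<open>w\<close>. This is the source of the strong subadditivity of capacity.\<close>

lemma lattice_inequality:
  assumes "u \<in> V" "v \<in> V" "\<And>x. 0 \<le> u x \<and> u x \<le> 1" "\<And>x. 0 \<le> v x \<and> v x \<le> 1"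
  defines "mx \<equiv> (\<lambda>x. max (u x) (v x))" and "mn \<equiv> (\<lambda>x. min (u x) (v x))"
  shows "mx \<in> V" "mn \<in> V" "B mx mx + B mn mn \<le> B u u + B v v"
proof -
  define w where "w = u - v"
  define p n where "p = trunc 1 w" and "n = trunc 1 (- w)"
  have wV: "w \<in> V" unfolding w_def using assms(1,2) by (auto intro: mem)
  have V: "p \<in> V" "n \<in> V" using wV markov mem unfolding p_def n_def by auto
  have w1: "\<bar>w x\<bar> \<le> 1" for x using assms(3)[of x] assms(4)[of x] unfolding w_def by (simp add: abs_le_iff)
  have pn: "p - w = n"
  proof
    show "(p - w) x = n x" for x using w1[of x] by (auto simp: p_def n_def trunc_def)
  qed
  have mx: "mx = v + p"
  proof
    show "mx x = (v + p) x" for x using w1[of x] by (auto simp: p_def trunc_def mx_def w_def)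
  qed
  have mn: "mn = u - p"
  proof
    show "mn x = (u - p) x" for x using w1[of x] by (auto simp: p_def trunc_def mn_def w_def)
  qed
  show "mx \<in> V" "mn \<in> V" unfolding mx mn using assms(1,2) V by (auto intro: mem)
  have "B p (p - w) \<le> 0" unfolding pn using pos_neg_part[OF wV w1] unfolding p_def n_def .
  then have "B p p + B p v - B p u \<le> 0"
    unfolding w_def using assms(1,2) V by (simp add: expand mem)
  then show "B mx mx + B mn mn \<le> B u u + B v v"
    unfolding mx mn using assms(1,2) V commute[OF V(1) assms(1)] commute[OF V(1) assms(2)] by (simp add: expand mem)
qed

text \<open>The squared defect of \<open>v\<close> on \<open>W\<close> is at most the square of
  \<open>s k - v\<close>, whose integral tends to zero; no almost everywhere convergent subsequence
  is extracted. The offset \<open>n\<close> fits sequences taken from shrinking sets, which meet a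
  constraint only from some index on.\<close>

lemma closed_ge_1:
  assumes "\<And>k::nat. s k \<in> V" "v \<in> V" "(\<lambda>k. nrm (s k - v)) \<longlonglongrightarrow> 0" "W \<in> sets \<mu>"
    and "\<And>k. k \<ge> n \<Longrightarrow> AE x in \<mu>. x \<in> W \<longrightarrow> 1 \<le> s k x"
  shows "AE x in \<mu>. x \<in> W \<longrightarrow> 1 \<le> v x"
proof -
  define h where "h x = indicator W x * (max 0 (1 - v x))\<^sup>2" for x
  have hm: "h \<in> borel_measurable \<mu>"
    unfolding h_def using assms measurable_V[OF assms(2)] by measurable
  have h0: "0 \<le> h x" for x unfolding h_def by simp
  have dV: "s k - v \<in> V" for k using assms(1,2) by (auto intro: mem)
  have hle: "AE x in \<mu>. h x \<le> ((s k - v) x)\<^sup>2" if k: "k \<ge> n" for k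
    using assms(5)[OF k]
  proof eventually_elim
    case (elim x)
    show ?case
    proof (cases "x \<in> W \<and> v x < 1")
      case True
      then have "h x = (1 - v x)\<^sup>2" by (simp add: h_def)
      also have "\<dots> \<le> (s k x - v x)\<^sup>2" using elim True by (intro power_mono) auto
      finally show ?thesis by simp
    qed (auto simp: h_def indicator_def)
  qed
  have int: "integrable \<mu> h"
    using hle[of n] h0 by (intro Bochner_Integration.integrable_bound[OF integrable_square[OF dV[of n]] hm]) auto
  have "(\<integral>x. h x \<partial>\<mu>) \<le> (nrm (s k - v))\<^sup>2" if "k \<ge> n" for k
  proof -
    have "(\<integral>x. h x \<partial>\<mu>) \<le> (\<integral>x. ((s k - v) x)\<^sup>2 \<partial>\<mu>)"
      by (intro integral_mono_AE int integrable_square dV hle that)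
    also have "\<dots> \<le> (nrm (s k - v))\<^sup>2" using L2_le[OF dV] nrm_square[OF dV] by simp
    finally show ?thesis .
  qed
  moreover have "(\<lambda>k. (nrm (s k - v))\<^sup>2) \<longlonglongrightarrow> 0\<^sup>2" by (intro tendsto_intros assms)
  ultimately have "(\<integral>x. h x \<partial>\<mu>) \<le> 0\<^sup>2" by (meson LIMSEQ_le_const)
  moreover have "(\<integral>x. h x \<partial>\<mu>) \<ge> 0" using h0 by simp
  ultimately have "(\<integral>x. h x \<partial>\<mu>) = 0" by simp
  then have "AE x in \<mu>. h x = 0"
    using integral_nonneg_eq_0_iff_AE[OF int] h0 by simp
  then show ?thesis
    by eventually_elim (auto simp: h_def max_def split: if_splits)
qed

text \<open>A bounded sequence of \<open>V\<close> that tends to zero in L2 tends weakly to zero, so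
  a functional constant along it vanishes. The sets \<open>C n\<close> of functions with L2 norm
  controlled by \<open>r n\<close> and value \<open>a\<close> are convex, hence contain a strongly
  convergent sequence; its limit is a null function on which \<open>\<phi>\<close> still takes the
  value \<open>a\<close>.\<close>

lemma weak_limit_zero:
  assumes \<phi>: "linear_functional_on V \<phi>" "\<And>u. u \<in> V \<Longrightarrow> \<bar>\<phi> u\<bar> \<le> c * nrm u"
    and m: "\<And>n::nat. m n \<in> V" "\<And>n. B (m n) (m n) \<le> R" "\<And>n. \<phi> (m n) = a"
    and r: "\<And>n. (\<integral>x. (m n x)\<^sup>2 \<partial>\<mu>) \<le> r n" "decseq r" "r \<longlonglongrightarrow> 0"
  shows "a = 0"
proof -
  define C where "C n = {u\<in>V. (\<integral>x. (u x)\<^sup>2 \<partial>\<mu>) \<le> r n \<and> \<phi> u = a}" for n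
  have conv: "convex (C n)" for n
  proof (rule convexI)
    fix u v and s t :: real
    assume uv: "u \<in> C n" "v \<in> C n" and st: "0 \<le> s" "0 \<le> t" "s + t = 1"
    have V: "u \<in> V" "v \<in> V" using uv C_def by auto
    have V': "s *\<^sub>R u \<in> V" "t *\<^sub>R v \<in> V" "s *\<^sub>R u + t *\<^sub>R v \<in> V" using V by (auto intro: mem)
    have "\<phi> (s *\<^sub>R u + t *\<^sub>R v) = \<phi> (s *\<^sub>R u) + \<phi> (t *\<^sub>R v)" "\<phi> (s *\<^sub>R u) = s * \<phi> u" "\<phi> (t *\<^sub>R v) = t * \<phi> v"
      using \<phi>(1) V V' unfolding linear_functional_on_def by blast+
    moreover have "\<phi> u = a" "\<phi> v = a" using uv C_def by auto
    ultimately have 1: "\<phi> (s *\<^sub>R u + t *\<^sub>R v) = a" using st(3) by (simp flip: distrib_right)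
    have "(s * x + t * y)\<^sup>2 \<le> s * x\<^sup>2 + t * y\<^sup>2" for x y :: real
    proof -
      have "s * x\<^sup>2 + t * y\<^sup>2 - (s * x + t * y)\<^sup>2 = s * t * (x - y)\<^sup>2"
      proof -
        have t: "t = 1 - s" using st(3) by simp
        show ?thesis unfolding t by (simp add: power2_eq_square algebra_simps)
      qed
      moreover have "0 \<le> s * t * (x - y)\<^sup>2" using st by simp
      ultimately show ?thesis by linarith
    qed
    then have "(\<integral>x. ((s *\<^sub>R u + t *\<^sub>R v) x)\<^sup>2 \<partial>\<mu>) \<le> (\<integral>x. s * (u x)\<^sup>2 + t * (v x)\<^sup>2 \<partial>\<mu>)"
      using integrable_square[OF V'(3)] integrable_square V by (intro integral_mono) (auto simp: scaleR_fun_def)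
    also have "\<dots> = s * (\<integral>x. (u x)\<^sup>2 \<partial>\<mu>) + t * (\<integral>x. (v x)\<^sup>2 \<partial>\<mu>)"
      using integrable_square V by simp
    also have "\<dots> \<le> s * r n + t * r n"
      using uv st unfolding C_def by (intro add_mono mult_left_mono) auto
    also have "\<dots> = r n" using st(3) by (simp flip: distrib_right)
    finally show "s *\<^sub>R u + t *\<^sub>R v \<in> C n" using 1 V' unfolding C_def by simp
  qed
  have dec: "C (Suc n) \<subseteq> C n" for n
    using decseq_SucD[OF r(2), of n] unfolding C_def by auto
  have ex: "\<exists>g\<in>C n. B g g \<le> R" for n
    using m r(1)[of n] unfolding C_def by (intro bexI[of _ "m n"]) auto
  have CV: "C n \<subseteq> V" for n unfolding C_def by auto
  obtain s v where sv: "\<forall>n. s n \<in> C n" "v \<in> V" "(\<lambda>n. nrm (s n - v)) \<longlonglongrightarrow> 0"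
    using convex_norm_selection[where C = C, OF CV conv dec ex] by blast
  have sV: "s n \<in> V" and sr: "(\<integral>x. (s n x)\<^sup>2 \<partial>\<mu>) \<le> r n" and sa: "\<phi> (s n) = a" for n
    using sv(1) unfolding C_def by auto
  have dV: "s n - v \<in> V" for n using sV sv(2) by (auto intro: mem)
  have "(\<integral>x. (v x)\<^sup>2 \<partial>\<mu>) \<le> 2 * (nrm (s n - v))\<^sup>2 + 2 * r n" for n
  proof -
    have "b\<^sup>2 \<le> 2 * (d - b)\<^sup>2 + 2 * d\<^sup>2" for b d :: real
    proof -
      have "0 \<le> (2 * d - b)\<^sup>2" by simp
      then show ?thesis by (simp add: power2_eq_square algebra_simps)
    qed
    then have "(\<integral>x. (v x)\<^sup>2 \<partial>\<mu>) \<le> (\<integral>x. 2 * ((s n - v) x)\<^sup>2 + 2 * (s n x)\<^sup>2 \<partial>\<mu>)"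
      using integrable_square[OF dV[of n]] integrable_square[OF sV] integrable_square[OF sv(2)] by (intro integral_mono) auto
    also have "\<dots> = 2 * (\<integral>x. ((s n - v) x)\<^sup>2 \<partial>\<mu>) + 2 * (\<integral>x. (s n x)\<^sup>2 \<partial>\<mu>)"
      using integrable_square[OF dV[of n]] integrable_square[OF sV] by simp
    also have "\<dots> \<le> 2 * (nrm (s n - v))\<^sup>2 + 2 * r n"
      using L2_le[OF dV] sr[of n] nrm_square[OF dV[of n]] by (intro add_mono mult_left_mono) auto
    finally show ?thesis .
  qed
  moreover have "(\<lambda>n. 2 * (nrm (s n - v))\<^sup>2 + 2 * r n) \<longlonglongrightarrow> 2 * 0\<^sup>2 + 2 * 0"
    by (intro tendsto_intros sv r)
  ultimately have "(\<integral>x. (v x)\<^sup>2 \<partial>\<mu>) \<le> 2 * 0\<^sup>2 + 2 * 0" by (intro LIMSEQ_le_const) auto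
  moreover have "(\<integral>x. (v x)\<^sup>2 \<partial>\<mu>) \<ge> 0" by simp
  ultimately have "AE x in \<mu>. (v x)\<^sup>2 = 0"
    using integral_nonneg_eq_0_iff_AE[OF integrable_square[OF sv(2)]] by simp
  then have "nrm v = 0" using sv(2) by (intro null_B) auto
  then have "\<phi> v = 0" using \<phi>(2)[OF sv(2)] by simp
  moreover have "(\<lambda>n. \<phi> (s n)) \<longlonglongrightarrow> \<phi> v" by (rule functional_tendsto[OF \<phi> sV sv(2,3)])
  ultimately show ?thesis using LIMSEQ_const_iff unfolding sa by auto
qed

end

section \<open>Topology and capacity\<close>

lemma closed_far_points: "closed {x::'a::metric_space. \<forall>y\<in>S. r \<le> dist x y}"
proof -
  have "{x. \<forall>y\<in>S. r \<le> dist x y} = (\<Inter>y\<in>S. {x. r \<le> dist x y})" by auto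
  moreover have "closed {x. r \<le> dist x y}" for y :: 'a
    by (intro closed_Collect_le continuous_intros)
  ultimately show ?thesis by auto
qed

text \<open>Quantifying over the complement instead of using \<open>infdist\<close>, which is 0 for
  the empty set, also covers \<open>U = UNIV\<close>.\<close>

lemma open_eq_UN_far_points:
  fixes U :: "'a::metric_space set"
  assumes "open U"
  shows "U = (\<Union>n. {x. \<forall>y\<in>-U. 1 / real (Suc n) \<le> dist x y})" (is "_ = (\<Union>n. ?F n)")
proof
  show "U \<subseteq> (\<Union>n. ?F n)"
  proof
    fix x assume "x \<in> U"
    then obtain e where e: "e > 0" "ball x e \<subseteq> U" using assms open_contains_ball by blast
    obtain n where "inverse (real (Suc n)) < e" using reals_Archimedean[OF e(1)] by blast
    then have "1 / real (Suc n) \<le> dist x y" if "y \<in> -U" for y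
    proof -
      have "\<not> dist x y < e" using that e(2) by (auto simp: subset_iff)
      then show ?thesis using \<open>inverse (real (Suc n)) < e\<close> by (simp add: divide_inverse)
    qed
    then show "x \<in> (\<Union>n. ?F n)" by blast
  qed
  show "(\<Union>n. ?F n) \<subseteq> U"
  proof
    fix x assume "x \<in> (\<Union>n. ?F n)"
    then obtain n where n: "\<forall>y\<in>-U. 1 / real (Suc n) \<le> dist x y" by blast
    show "x \<in> U"
    proof (rule ccontr)
      assume "x \<notin> U"
      then have "1 / real (Suc n) \<le> dist x x" using n by blast
      then show False by simp
    qed
  qed
qed

lemma incseq_far_points:
  "incseq (\<lambda>n. {x::'a::metric_space. \<forall>y\<in>S. 1 / real (Suc n) \<le> dist x y})"
proof (rule incseq_SucI, rule subsetI)
  fix n and x :: 'a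
  assume x: "x \<in> {x. \<forall>y\<in>S. 1 / real (Suc n) \<le> dist x y}"
  have "1 / real (Suc (Suc n)) \<le> 1 / real (Suc n)" by (intro divide_left_mono) auto
  then show "x \<in> {x. \<forall>y\<in>S. 1 / real (Suc (Suc n)) \<le> dist x y}" using x by force
qed

text \<open>The interiors have to cover, not just the sets: this places every compact set inside a
  single \<open>Q n\<close>.\<close>

definition compact_exhaustion :: "(nat \<Rightarrow> 'a::topological_space set) \<Rightarrow> bool" where
  "compact_exhaustion Q \<longleftrightarrow> incseq Q \<and> (\<forall>n. compact (Q n)) \<and> (\<forall>x. \<exists>n. x \<in> interior (Q n))"

lemma compact_exhaustion_exists:
  assumes "locally_compact_space (euclidean :: 'a::metric_space topology)"
    and "separable_space (euclidean :: 'a topology)"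
  shows "\<exists>Q :: nat \<Rightarrow> 'a set. compact_exhaustion Q"
proof -
  obtain D :: "'a set" where D: "countable D" "closure D = UNIV"
    using assms(2) unfolding separable_space_def by auto
  define S where "S = {cball d r | d r. d \<in> D \<and> r \<in> \<rat> \<and> compact (cball d r)}"
  have "S \<subseteq> (\<lambda>(d, r). cball d r) ` (D \<times> \<rat>)" unfolding S_def by auto
  then have count: "countable S"
    by (rule countable_subset) (intro countable_image countable_SIGMA D countable_rat)
  have cover: "\<exists>K\<in>S. x \<in> interior K" for x :: 'a
  proof -
    obtain U K where UK: "open U" "compact K" "x \<in> U" "U \<subseteq> K"
      using assms(1) unfolding locally_compact_space_def by simp metis
    obtain e where e: "e > 0" "ball x e \<subseteq> U" using UK(1,3) open_contains_ball by blast
    \<comment> \<open>With radius below \<open>e / 2\<close>, a ball whose center is within the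
      radius of \<open>x\<close> stays in \<open>ball x e\<close>, hence in the compact
      neighborhood. Rational radii keep the family countable.\<close>
    obtain q where q: "0 < real_of_rat q" "real_of_rat q < e / 2"
      using of_rat_dense[of 0 "e/2"] e by auto
    define r where "r = real_of_rat q"
    have r: "0 < r" "r < e / 2" "r \<in> \<rat>" using q by (auto simp: r_def)
    obtain d where d: "d \<in> D" "dist d x < r"
      using D(2) r(1) closure_approachable[of x D] by auto
    have "cball d r \<subseteq> ball x e"
    proof
      fix z assume "z \<in> cball d r"
      then have "dist x z < e" using d r dist_triangle[of x z d] by (simp add: dist_commute)
      then show "z \<in> ball x e" by simp
    qed
    then have "cball d r \<subseteq> K" using e UK by blast
    then have "compact (cball d r)" using UK(2) closed_cball closed_Int_compact[of "cball d r" K]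
      by (simp add: Int_absorb2)
    moreover have "x \<in> interior (cball d r)"
      using d(2) by (intro interiorI[of "ball d r"]) auto
    ultimately show ?thesis using d(1) r(3) unfolding S_def by blast
  qed
  have ne: "S \<noteq> {}" using cover by blast
  define Q where "Q n = (\<Union>i\<le>n. from_nat_into S i)" for n
  have "incseq Q" unfolding Q_def incseq_def by (auto intro: order_trans)
  moreover have "compact (Q n)" for n
  proof -
    have "\<forall>K\<in>S. compact K" unfolding S_def by auto
    then have "compact (from_nat_into S i)" for i using from_nat_into[OF ne] by blast
    then show ?thesis unfolding Q_def by (intro compact_UN) auto
  qed
  moreover have "\<exists>n. x \<in> interior (Q n)" for x
  proof -
    obtain K where K: "K \<in> S" "x \<in> interior K" using cover by blast
    then obtain n where "from_nat_into S n = K" using from_nat_into_surj[OF count] by blast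
    then have "K \<subseteq> Q n" unfolding Q_def by auto
    then show ?thesis using K(2) interior_mono by blast
  qed
  ultimately show ?thesis unfolding compact_exhaustion_def by blast
qed

lemma compact_subset_exhaustion:
  assumes "compact_exhaustion Q" "compact K"
  shows "\<exists>n. K \<subseteq> interior (Q n)"
proof -
  have inc: "incseq Q" and cov: "\<And>x. \<exists>n. x \<in> interior (Q n)" 
    using assms(1) unfolding compact_exhaustion_def by auto
  have "K \<subseteq> (\<Union>n\<in>UNIV. interior (Q n))" using cov by blast
  then obtain I where I: "finite I" "K \<subseteq> (\<Union>n\<in>I. interior (Q n))"
    using compactE_image[OF assms(2), of UNIV "\<lambda>n. interior (Q n)"] by auto
  have "interior (Q n) \<subseteq> interior (Q (Max (insert 0 I)))" if "n \<in> I" for n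
    using I(1) that by (intro interior_mono incseqD[OF inc]) simp
  then show ?thesis using I(2) by blast
qed

lemma open_compact_exhaustion:
  fixes U :: "'a::metric_space set"
  assumes "compact_exhaustion (Q :: nat \<Rightarrow> 'a set)" "open U"
  shows "\<exists>C. incseq C \<and> (\<forall>n::nat. compact (C n)) \<and> (\<Union>n. C n) = U"
proof -
  define F where "F n = {x. \<forall>y\<in>-U. 1 / real (Suc n) \<le> dist x y}" for n
  have Q: "incseq Q" "\<And>n. compact (Q n)" "\<And>x. \<exists>n. x \<in> Q n"
    using assms(1) interior_subset unfolding compact_exhaustion_def by blast+
  have F: "incseq F" "U = (\<Union>n. F n)" "\<And>n. closed (F n)"
    unfolding F_def using incseq_far_points[of "-U"] open_eq_UN_far_points[OF assms(2)] closed_far_points by auto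
  have "incseq (\<lambda>n. Q n \<inter> F n)" using Q(1) F(1) unfolding incseq_def by blast
  moreover have "compact (Q n \<inter> F n)" for n using Q(2) F(3) by (rule compact_Int_closed)
  moreover have "(\<Union>n. Q n \<inter> F n) = U"
  proof
    show "(\<Union>n. Q n \<inter> F n) \<subseteq> U" using F(2) by blast
    show "U \<subseteq> (\<Union>n. Q n \<inter> F n)"
    proof
      fix x assume "x \<in> U"
      then obtain m where m: "x \<in> F m" using F(2) by blast
      obtain n where n: "x \<in> Q n" using Q(3) by blast
      have "x \<in> Q (max m n)" "x \<in> F (max m n)"
        using m n incseqD[OF Q(1), of n "max m n"] incseqD[OF F(1), of m "max m n"] by auto
      then show "x \<in> (\<Union>n. Q n \<inter> F n)" by blast
    qed
  qed
  ultimately show ?thesis by blast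
qed

text \<open>The sets that can be squeezed between closed and open sets of nearly equal measure form
  a sigma-algebra containing the open sets. Complements exchange the two approximating sets; the
  finiteness of \<open>N\<close> is used through continuity along decreasing sequences.\<close>

lemma finite_measure_closed_open_approx:
  fixes N :: "'a::metric_space measure"
  assumes "finite_measure N" "sets N = sets borel" "X \<in> sets borel"
  shows "\<forall>e>0. \<exists>U F. open U \<and> closed F \<and> F \<subseteq> X \<and> X \<subseteq> U \<and> measure N (U - F) < e"
proof -
  interpret finite_measure N by fact
  have sets_open: "open U \<Longrightarrow> U \<in> sets N" and sets_closed: "closed U \<Longrightarrow> U \<in> sets N" for U
    using assms(2) by auto
  have "X \<in> sigma_sets UNIV {S. open S}" using assms(3) by (simp add: borel_def)
  then show ?thesis
  proof (induction rule: sigma_sets.induct)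
    case (Basic U)
    then have U: "open U" by simp
    define F where "F n = {x. \<forall>y\<in>-U. 1 / real (Suc n) \<le> dist x y}" for n
    have F: "incseq F" "U = (\<Union>n. F n)" "\<And>n. closed (F n)"
      unfolding F_def using incseq_far_points[of "-U"] open_eq_UN_far_points[OF U] closed_far_points by auto
    have "decseq (\<lambda>n. U - F n)" using F(1) unfolding incseq_def decseq_def by blast
    then have "(\<lambda>n. measure N (U - F n)) \<longlonglongrightarrow> measure N (\<Inter>n. U - F n)"
      using U F(3) sets_open sets_closed by (intro finite_Lim_measure_decseq) auto
    moreover have "(\<Inter>n. U - F n) = {}" using F(2) by auto
    ultimately have lim: "(\<lambda>n. measure N (U - F n)) \<longlonglongrightarrow> 0" by (metis measure_empty)
    show ?case
    proof (intro allI impI)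
      fix e :: real assume "e > 0"
      then obtain n where "measure N (U - F n) < e"
        using order_tendstoD(2)[OF lim] eventually_happens[of _ sequentially] by fastforce
      then show "\<exists>U' F. open U' \<and> closed F \<and> F \<subseteq> U \<and> U \<subseteq> U' \<and> measure N (U' - F) < e"
        using U F by (intro exI[of _ U] exI[of _ "F n"]) auto
    qed
  next
    case Empty
    have "open ({} :: 'a set) \<and> closed ({} :: 'a set) \<and> measure N ({} - {}) < e" if "e > 0" for e
      using that by simp
    then show ?case by blast
  next
    case (Compl A)
    show ?case
    proof (intro allI impI)
      fix e :: real assume "e > 0"
      then obtain U F where UF: "open U" "closed F" "F \<subseteq> A" "A \<subseteq> U" "measure N (U - F) < e"
        using Compl.IH by meson
      have "- F - (- U) = U - F" by blast
      then have "open (- F) \<and> closed (- U) \<and> - U \<subseteq> UNIV - A \<and> UNIV - A \<subseteq> - F \<and> measure N (- F - (- U)) < e"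
        using UF by (simp add: closed_open[symmetric] open_closed[symmetric] subset_iff) blast
      then show "\<exists>U F. open U \<and> closed F \<and> F \<subseteq> UNIV - A \<and> UNIV - A \<subseteq> U \<and> measure N (U - F) < e"
        by (intro exI)
    qed
  next
    case (Union A)
    show ?case
    proof (intro allI impI)
      fix e :: real assume e: "e > 0"
      \<comment> \<open>The errors sum to \<open>e / 2\<close>, which leaves a margin for stopping
        the union of closed sets at a finite stage.\<close>
      have "\<forall>i. \<exists>U F. open U \<and> closed F \<and> F \<subseteq> A i \<and> A i \<subseteq> U \<and> measure N (U - F) < e / 2 * (1/2) ^ Suc i"
      proof
        fix i
        have "0 < e / 2 * (1/2) ^ Suc i" using e by simp
        then show "\<exists>U F. open U \<and> closed F \<and> F \<subseteq> A i \<and> A i \<subseteq> U \<and> measure N (U - F) < e / 2 * (1/2) ^ Suc i"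
          using Union.IH[of i] by (elim allE impE)
      qed
      then obtain U F where UF: "\<And>i. open (U i)" "\<And>i. closed (F i)" "\<And>i. F i \<subseteq> A i" "\<And>i. A i \<subseteq> U i"
        "\<And>i. measure N (U i - F i) < e / 2 * (1/2) ^ Suc i" by metis
      define W where "W = (\<Union>i. U i)"
      define H where "H k = (\<Union>i\<le>k. F i)" for k :: nat
      have W: "open W" unfolding W_def using UF by auto
      have H: "closed (H k)" for k unfolding H_def using UF by (intro closed_UN) auto
      \<comment> \<open>The union of all \<open>F i\<close> need not be closed, so finite unions are
        used and the remainder is controlled by its decreasing limit.\<close>
      have "decseq (\<lambda>k. W - H k)" unfolding decseq_def H_def by fastforce
      then have lim: "(\<lambda>k. measure N (W - H k)) \<longlonglongrightarrow> measure N (\<Inter>k. W - H k)"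
        using W H sets_open sets_closed by (intro finite_Lim_measure_decseq) auto
      have sub: "(\<Inter>k. W - H k) \<subseteq> (\<Union>i. U i - F i)" unfolding W_def H_def by auto
      have meas: "U i - F i \<in> sets N" for i using UF sets_open sets_closed by auto
      have sums: "(\<lambda>i. e / 2 * (1/2) ^ Suc i) sums (e / 2 * 1)"
        by (intro sums_mult power_half_series)
      have summ: "summable (\<lambda>i. measure N (U i - F i))"
        using UF(5) by (intro summable_comparison_test'[OF sums_summable[OF sums], of 0]) (auto intro: less_imp_le)
      have "measure N (\<Inter>k. W - H k) \<le> measure N (\<Union>i. U i - F i)"
        using sub meas by (intro finite_measure_mono) auto
      also have "\<dots> \<le> (\<Sum>i. measure N (U i - F i))"
        using summ meas by (intro finite_measure_subadditive_countably) auto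
      also have "\<dots> \<le> (\<Sum>i. e / 2 * (1/2) ^ Suc i)"
        using UF(5) by (intro suminf_le summ sums_summable[OF sums] less_imp_le)
      also have "\<dots> = e / 2" using sums_unique[OF sums] by simp
      finally have "measure N (\<Inter>k. W - H k) < e" using e by simp
      then obtain k where "measure N (W - H k) < e"
        using order_tendstoD(2)[OF lim] eventually_happens[of _ sequentially] by fastforce
      moreover have "H k \<subseteq> (\<Union>i. A i)" unfolding H_def using UF(3) by blast
      moreover have "(\<Union>i. A i) \<subseteq> W" unfolding W_def using UF(4) by blast
      ultimately show "\<exists>U F. open U \<and> closed F \<and> F \<subseteq> (\<Union>i. A i) \<and> (\<Union>i. A i) \<subseteq> U \<and> measure N (U - F) < e"
        by (intro exI[of _ W] exI[of _ "H k"] conjI W H)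
    qed
  qed
qed

lemma ennreal_pos_below:
  fixes x :: ennreal
  assumes "0 < x"
  shows "\<exists>c>0. ennreal c < x"
proof -
  obtain c where c: "0 < c" "c < x" using dense[OF assms] by blast
  then have "c < top" using less_le_trans top_greatest by blast
  then have "c = ennreal (enn2real c)" "0 < enn2real c" using c by (auto simp: enn2real_positive_iff)
  then show ?thesis using c by metis
qed

lemma choice_pair: "(\<And>n. \<exists>u U. P n u U) \<Longrightarrow> \<exists>u U. \<forall>n. P n (u n) (U n)"
  by metis

lemma ennreal_zero_epsilon:
  fixes x :: ennreal
  assumes "\<And>e::real. e > 0 \<Longrightarrow> x \<le> ennreal e"
  shows "x = 0"
proof -
  have "x \<le> 0 + ennreal e" if "e > 0" for e using assms[OF that] by simp
  then have "x \<le> 0" by (rule ennreal_le_epsilon)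
  then show ?thesis by simp
qed

text \<open>Since the measure may be infinite, outer approximation is applied to its finite
  restrictions to the sets \<open>Q n\<close>, with error \<open>1 / Suc k\<close>; intersecting
  over all pairs \<open>(n, k)\<close> makes every restriction vanish.\<close>

lemma null_set_in_null_Gdelta:
  fixes M :: "'a::metric_space measure"
  assumes M: "sets M = sets borel" "\<And>K. compact K \<Longrightarrow> emeasure M K < \<infinity>"
    and Q: "compact_exhaustion (Q :: nat \<Rightarrow> 'a set)"
    and A: "A \<in> sets borel" "emeasure M A = 0"
  shows "\<exists>G. (\<forall>n::nat. open (G n)) \<and> A \<subseteq> (\<Inter>n. G n) \<and> emeasure M (\<Inter>n. G n) = 0"
proof -
  have Qc: "compact (Q n)" for n using Q unfolding compact_exhaustion_def by blast
  have Qs: "Q n \<in> sets M" for n using compact_imp_closed[OF Qc] M(1) by auto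
  have Ux: "\<exists>n. x \<in> Q n" for x using Q interior_subset unfolding compact_exhaustion_def by blast
  have "\<exists>U. open U \<and> A \<subseteq> U \<and> emeasure M (Q n \<inter> U) < ennreal (1 / real (Suc k))" for n k
  proof -
    define N where "N = density M (indicator (Q n))"
    have sN: "sets N = sets borel" unfolding N_def using M(1) by simp
    have eN: "emeasure N X = emeasure M (Q n \<inter> X)" if "X \<in> sets borel" for X
      unfolding N_def using that Qs M(1) by (subst emeasure_density) (auto simp: indicator_inter_arith[symmetric] Int_commute)
    have "emeasure N (space N) \<noteq> \<infinity>"
    proof -
      have "space N = UNIV" using sN sets_eq_imp_space_eq by fastforce
      then show ?thesis using eN[of UNIV] M(2)[OF Qc[of n]] by simp
    qed
    then interpret finite_measure N by (intro finite_measureI) simp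
    obtain U F where UF: "open U" "closed F" "F \<subseteq> A" "A \<subseteq> U" "measure N (U - F) < 1 / real (Suc k)"
      using finite_measure_closed_open_approx[OF finite_measure_axioms sN A(1)] 
      by (metis divide_pos_pos of_nat_0_less_iff zero_less_Suc zero_less_one)
    have "emeasure N F \<le> emeasure M A"
      using UF eN[of F] A(1) M(1) by (auto intro: emeasure_mono)
    then have "emeasure N F = 0" using A by simp
    \<comment> \<open>The closed set \<open>F\<close> lies in the null set \<open>A\<close>, so all
      the measure of \<open>U\<close> sits in \<open>U - F\<close>.\<close>
    then have "emeasure N U \<le> emeasure N (U - F)"
      using emeasure_subadditive[of "U - F" N F] UF sN emeasure_mono[of U "(U - F) \<union> F" N]
      by (auto intro: order_trans)
    also have "\<dots> < ennreal (1 / real (Suc k))" 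
      using UF(5) by (simp add: emeasure_eq_measure ennreal_less_iff)
    finally show ?thesis using UF eN[of U] by auto
  qed
  then obtain G where G: "\<And>n k. open (G n k)" "\<And>n k. A \<subseteq> G n k"
    "\<And>n k. emeasure M (Q n \<inter> G n k) < ennreal (1 / real (Suc k))" by metis
  define I where "I = (\<Inter>m. (case prod_decode m of (n, k) \<Rightarrow> G n k))"
  have IG: "I \<subseteq> G n k" for n k
    unfolding I_def using INF_lower[of "prod_encode (n, k)" UNIV "\<lambda>m. case prod_decode m of (n, k) \<Rightarrow> G n k"] by simp
  have Is: "I \<in> sets M" unfolding I_def M(1) using G(1) by (auto split: prod.split)
  have "Q n \<inter> I \<in> null_sets M" for n
  proof -
    have "emeasure M (Q n \<inter> I) \<le> ennreal e" if e: "e > 0" for e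
    proof -
      obtain k where k: "inverse (real (Suc k)) < e" using reals_Archimedean[OF e] by blast
      have "emeasure M (Q n \<inter> I) \<le> emeasure M (Q n \<inter> G n k)"
        using IG Qs G(1) M(1) by (intro emeasure_mono) auto
      also have "\<dots> \<le> ennreal (1 / real (Suc k))" using G(3) by (rule less_imp_le)
      also have "\<dots> \<le> ennreal e" using k by (intro ennreal_leI) (simp add: divide_inverse)
      finally show ?thesis by simp
    qed
    then have "emeasure M (Q n \<inter> I) = 0" by (rule ennreal_zero_epsilon)
    then show ?thesis using Is Qs by (auto simp: null_sets_def)
  qed
  then have "(\<Union>n. Q n \<inter> I) \<in> null_sets M" by (intro null_sets_UN)
  moreover have "(\<Union>n. Q n \<inter> I) = I" using Ux by auto
  ultimately have "emeasure M I = 0" by auto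
  moreover have "open (case prod_decode m of (n, k) \<Rightarrow> G n k)" for m using G(1) by (auto split: prod.split)
  moreover have "A \<subseteq> I" unfolding I_def using G(2) by (intro INF_greatest) (auto split: prod.split)
  ultimately show ?thesis unfolding I_def
    by (intro exI[of _ "\<lambda>m. case prod_decode m of (n, k) \<Rightarrow> G n k"] conjI allI)
qed

section \<open>Capacity as a set function\<close>

context dirichlet
begin

abbreviation capacity :: "'a set \<Rightarrow> ennreal" where "capacity \<equiv> cap \<mu> V E"

lemma cap_le:
  assumes "u \<in> V" "open U" "A \<subseteq> U" "AE x in \<mu>. x \<in> U \<longrightarrow> 1 \<le> u x"
  shows "capacity A \<le> ennreal (B u u)"
  unfolding cap_def using assms by (intro Inf_lower) blast

text \<open>Truncation keeps the constraint and does not raise the energy, so near-optimal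
  competitors may be taken with values in [0, 1], as the lattice inequality requires.\<close>

lemma cap_less:
  assumes "capacity A < ennreal c"
  shows "\<exists>u U. open U \<and> A \<subseteq> U \<and> u \<in> V \<and> (\<forall>x. 0 \<le> u x \<and> u x \<le> 1) \<and>
    (AE x in \<mu>. x \<in> U \<longrightarrow> 1 \<le> u x) \<and> B u u < c"
proof -
  obtain u U where u: "u \<in> V" "open U" "A \<subseteq> U" "AE x in \<mu>. x \<in> U \<longrightarrow> 1 \<le> u x"
    "ennreal (B u u) < ennreal c"
    using assms unfolding cap_def Inf_less_iff by blast
  have "B u u < c" using u(5) nonneg[OF u(1)] by (simp add: ennreal_less_iff)
  then have "B (trunc 1 u) (trunc 1 u) < c" using trunc_1_contract[OF u(1)] by simp
  moreover have "AE x in \<mu>. x \<in> U \<longrightarrow> 1 \<le> trunc 1 u x"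
    using u(4) by eventually_elim (auto simp: trunc_def)
  moreover have "0 \<le> trunc 1 u x \<and> trunc 1 u x \<le> 1" for x by (simp add: trunc_def)
  ultimately show ?thesis using u(2,3) markov(1)[OF u(1)] by (intro exI[of _ "trunc 1 u"] exI[of _ U]) simp
qed

lemma cap_mono: "A \<subseteq> A' \<Longrightarrow> capacity A \<le> capacity A'"
  unfolding cap_def by (intro Inf_superset_mono) blast

lemma cap_null_Un:
  assumes "capacity A = 0" "capacity A' = 0"
  shows "capacity (A \<union> A') = 0"
proof -
  have "capacity (A \<union> A') \<le> ennreal e" if e: "e > 0" for e
  proof -
    have small: "capacity A < ennreal (e/2)" "capacity A' < ennreal (e/2)" using assms e by auto
    obtain u U where u: "open U" "A \<subseteq> U" "u \<in> V" "\<And>x. 0 \<le> u x \<and> u x \<le> 1"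
        "AE x in \<mu>. x \<in> U \<longrightarrow> 1 \<le> u x" "B u u < e/2"
      using cap_less[OF small(1)] by blast
    obtain v U' where v: "open U'" "A' \<subseteq> U'" "v \<in> V" "\<And>x. 0 \<le> v x \<and> v x \<le> 1"
        "AE x in \<mu>. x \<in> U' \<longrightarrow> 1 \<le> v x" "B v v < e/2"
      using cap_less[OF small(2)] by blast
    define mx where "mx = (\<lambda>x. max (u x) (v x))"
    have V: "mx \<in> V" "(\<lambda>x. min (u x) (v x)) \<in> V"
      using lattice_inequality[OF u(3) v(3) u(4) v(4)] unfolding mx_def by blast+
    have "B mx mx \<le> B u u + B v v"
      using lattice_inequality(3)[OF u(3) v(3) u(4) v(4)] nonneg[OF V(2)] unfolding mx_def by linarith
    also have "\<dots> \<le> e" using u v by simp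
    finally have le: "B mx mx \<le> e" .
    have "AE x in \<mu>. x \<in> U \<union> U' \<longrightarrow> 1 \<le> mx x"
      using u(5) v(5) by eventually_elim (auto simp: mx_def)
    then have "capacity (A \<union> A') \<le> ennreal (B mx mx)"
      using open_Un[OF u(1) v(1)] Un_mono[OF u(2) v(2)] cap_le[OF V(1)] by blast
    also have "\<dots> \<le> ennreal e" using le by (rule ennreal_leI)
    finally show ?thesis by simp
  qed
  then show ?thesis by (rule ennreal_zero_epsilon)
qed

text \<open>A truncated competitor equals 1 almost everywhere on an open set around
  \<open>A\<close>, so the measure of \<open>A\<close> is at most its squared L2 norm and hence its
  energy.\<close>

lemma cap_zero_imp_null:
  assumes "capacity A = 0" "A \<in> sets \<mu>"
  shows "emeasure \<mu> A = 0"
proof -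
  have "emeasure \<mu> A \<le> ennreal e" if e: "e > 0" for e
  proof -
    have "capacity A < ennreal e" using assms e by simp
    from cap_less[OF this] obtain u U where u: "open U" "A \<subseteq> U" "u \<in> V" "\<And>x. 0 \<le> u x \<and> u x \<le> 1"
        "AE x in \<mu>. x \<in> U \<longrightarrow> 1 \<le> u x" "B u u < e"
      by blast
    have Us: "U \<in> sets \<mu>" using u(1) borel by simp
    have "emeasure \<mu> A \<le> emeasure \<mu> U" using u Us by (intro emeasure_mono)
    also have "\<dots> = (\<integral>\<^sup>+x. indicator U x \<partial>\<mu>)" using Us by simp
    also have "\<dots> \<le> (\<integral>\<^sup>+x. ennreal ((u x)\<^sup>2) \<partial>\<mu>)"
    proof (intro nn_integral_mono_AE)
      show "AE x in \<mu>. indicator U x \<le> ennreal ((u x)\<^sup>2)"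
        using u(5)
      proof eventually_elim
        case (elim x)
        have "x \<in> U \<Longrightarrow> u x = 1" using elim u(4)[of x] by simp
        then show ?case by (auto simp: indicator_def)
      qed
    qed
    also have "\<dots> = ennreal (\<integral>x. (u x)\<^sup>2 \<partial>\<mu>)"
      using integrable_square[OF u(3)] by (intro nn_integral_eq_integral) auto
    also have "\<dots> \<le> ennreal e" using L2_le[OF u(3)] u(6) by (intro ennreal_leI) simp
    finally show ?thesis by simp
  qed
  then show ?thesis by (rule ennreal_zero_epsilon)
qed

text \<open>Near-optimal competitors \<open>u n\<close> are glued by running maxima
  \<open>g n\<close>. The minimum of \<open>g n\<close> and the next competitor is still admissible
  for \<open>A n\<close> and so costs at least its capacity; the lattice inequality therefore
  telescopes and only the small errors add up. A limit of the bounded sequence is admissible for the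
  union.\<close>

lemma cap_increasing_union:
  assumes "incseq A" "\<And>n::nat. capacity (A n) \<le> ennreal c" "c \<ge> 0"
  shows "capacity (\<Union>n. A n) \<le> ennreal c"
proof (rule ennreal_le_epsilon)
  fix \<epsilon> :: real assume \<epsilon>: "\<epsilon> > 0"
  define a where "a n = enn2real (capacity (A n))" for n
  have fin: "capacity (A n) < top" for n using le_less_trans[OF assms(2) ennreal_less_top] .
  have a: "capacity (A n) = ennreal (a n)" "a n \<le> c" "0 \<le> a n" for n
    using fin[of n] assms(2)[of n] assms(3) unfolding a_def by (auto simp: enn2real_leI)
  have "\<exists>u U. open U \<and> A n \<subseteq> U \<and> u \<in> V \<and> (\<forall>x. 0 \<le> u x \<and> u x \<le> 1) \<and>
      (AE x in \<mu>. x \<in> U \<longrightarrow> 1 \<le> u x) \<and> B u u < a n + \<epsilon> * (1/2) ^ Suc n" for n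
  proof -
    \<comment> \<open>The errors \<open>\<epsilon> / 2 ^ Suc n\<close> sum to
      \<open>\<epsilon>\<close>.\<close>
    have "capacity (A n) < ennreal (a n + \<epsilon> * (1/2) ^ Suc n)"
      unfolding a(1) using a(3) \<epsilon> by (intro ennreal_lessI) (auto intro: add_nonneg_pos)
    then show ?thesis by (rule cap_less)
  qed
  then have "\<exists>u U. \<forall>n. open (U n) \<and> A n \<subseteq> U n \<and> u n \<in> V \<and> (\<forall>x. 0 \<le> u n x \<and> u n x \<le> 1) \<and>
      (AE x in \<mu>. x \<in> U n \<longrightarrow> 1 \<le> u n x) \<and> B (u n) (u n) < a n + \<epsilon> * (1/2) ^ Suc n"
    by (rule choice_pair)
  then obtain u U where U: "\<And>n. open (U n)" "\<And>n. A n \<subseteq> U n"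
    and u: "\<And>n. u n \<in> V" "\<And>n x. 0 \<le> u n x \<and> u n x \<le> 1"
      "\<And>n. AE x in \<mu>. x \<in> U n \<longrightarrow> 1 \<le> u n x" "\<And>n. B (u n) (u n) < a n + \<epsilon> * (1/2) ^ Suc n"
    by blast
  define g where "g = rec_nat (u 0) (\<lambda>n h x. max (h x) (u (Suc n) x))"
  have g: "g 0 = u 0" "\<And>n. g (Suc n) = (\<lambda>x. max (g n x) (u (Suc n) x))" unfolding g_def by simp_all
  define W where "W n = (\<Union>i\<le>n. U i)" for n
  have W: "open (W n)" "W n \<in> sets \<mu>" for n unfolding W_def borel using U by auto
  have ginv: "g n \<in> V \<and> (\<forall>x. 0 \<le> g n x \<and> g n x \<le> 1) \<and> (AE x in \<mu>. x \<in> W n \<longrightarrow> 1 \<le> g n x) \<and>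
      B (g n) (g n) \<le> a n + \<epsilon> * (1 - (1/2) ^ Suc n)" for n
  proof (induction n)
    case 0
    then show ?case using u(1,2)[of 0] u(3)[of 0] u(4)[of 0] by (auto simp: g W_def)
  next
    case (Suc n)
    then have G: "g n \<in> V" "\<And>x. 0 \<le> g n x \<and> g n x \<le> 1" "AE x in \<mu>. x \<in> W n \<longrightarrow> 1 \<le> g n x"
      "B (g n) (g n) \<le> a n + \<epsilon> * (1 - (1/2) ^ Suc n)" by auto
    define mn where "mn = (\<lambda>x. min (g n x) (u (Suc n) x))"
    have L: "g (Suc n) \<in> V" "mn \<in> V"
      "B (g (Suc n)) (g (Suc n)) + B mn mn \<le> B (g n) (g n) + B (u (Suc n)) (u (Suc n))"
      unfolding g(2) mn_def using lattice_inequality[OF G(1) u(1) G(2) u(2)] by blast+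
    \<comment> \<open>As \<open>A n\<close> lies in \<open>A (Suc n)\<close>, it is contained in
      both open sets. The resulting bound \<open>a n \<le> B mn mn\<close> cancels the term
      \<open>a n\<close> in the energy of \<open>g n\<close>.\<close>
    have "AE x in \<mu>. x \<in> W n \<inter> U (Suc n) \<longrightarrow> 1 \<le> mn x"
      using G(3) u(3)[of "Suc n"] by eventually_elim (auto simp: mn_def)
    moreover have "A n \<subseteq> W n \<inter> U (Suc n)"
      using U(2)[of n] U(2)[of "Suc n"] incseq_SucD[OF assms(1), of n] unfolding W_def by blast
    ultimately have "ennreal (a n) \<le> ennreal (B mn mn)"
      unfolding a(1)[symmetric] using open_Int[OF W(1) U(1)] cap_le[OF L(2)] by blast
    then have "a n \<le> B mn mn" using nonneg[OF L(2)] by simp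
    then have "B (g (Suc n)) (g (Suc n)) \<le> a (Suc n) + \<epsilon> * (1 - (1/2) ^ Suc (Suc n))"
      using L(3) G(4) u(4)[of "Suc n"] by (simp add: algebra_simps)
    moreover have "AE x in \<mu>. x \<in> W (Suc n) \<longrightarrow> 1 \<le> g (Suc n) x"
      using G(3) u(3)[of "Suc n"] by eventually_elim (auto simp: g W_def le_Suc_eq)
    moreover have "0 \<le> g (Suc n) x \<and> g (Suc n) x \<le> 1" for x
      using G(2)[of x] u(2)[of "Suc n" x] by (auto simp: g)
    ultimately show ?case using L(1) by blast
  qed
  \<comment> \<open>The functions \<open>g n\<close> themselves need not converge; membership in
    these decreasing convex sets is what passes to a convergent selection.\<close>
  define C where "C n = {v\<in>V. AE x in \<mu>. x \<in> W n \<longrightarrow> 1 \<le> v x}" for n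
  have "convex (C n)" for n
  proof (rule convexI)
    fix v w and s t :: real
    assume vw: "v \<in> C n" "w \<in> C n" and st: "0 \<le> s" "0 \<le> t" "s + t = 1"
    have "AE x in \<mu>. x \<in> W n \<longrightarrow> 1 \<le> v x" "AE x in \<mu>. x \<in> W n \<longrightarrow> 1 \<le> w x"
      using vw C_def by auto
    then have "AE x in \<mu>. x \<in> W n \<longrightarrow> 1 \<le> (s *\<^sub>R v + t *\<^sub>R w) x"
    proof eventually_elim
      case (elim x)
      show ?case
      proof
        assume "x \<in> W n"
        then have "s * 1 + t * 1 \<le> s * v x + t * w x"
          using elim st by (intro add_mono mult_left_mono) auto
        then show "1 \<le> (s *\<^sub>R v + t *\<^sub>R w) x" using st by (simp add: scaleR_fun_def)
      qed
    qed
    then show "s *\<^sub>R v + t *\<^sub>R w \<in> C n" using vw unfolding C_def by (auto intro: mem)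
  qed
  moreover have "C (Suc n) \<subseteq> C n" for n
    unfolding C_def W_def by (auto elim!: eventually_mono)
  moreover have "\<exists>h\<in>C n. B h h \<le> c + \<epsilon>" for n
  proof (rule bexI[of _ "g n"])
    have "\<epsilon> * (1 - (1/2) ^ Suc n) \<le> \<epsilon> * 1" using \<epsilon> by (intro mult_left_mono) auto
    then show "B (g n) (g n) \<le> c + \<epsilon>" using ginv[of n] a(2)[of n] by linarith
    show "g n \<in> C n" using ginv[of n] unfolding C_def by simp
  qed
  ultimately have "\<exists>s v. (\<forall>n. s n \<in> C n) \<and> v \<in> V \<and> (\<lambda>n. nrm (s n - v)) \<longlonglongrightarrow> 0 \<and> B v v \<le> c + \<epsilon>"
    by (intro convex_norm_selection) (auto simp: C_def)
  then obtain s v where sv: "\<And>n. s n \<in> C n" "v \<in> V" "(\<lambda>n. nrm (s n - v)) \<longlonglongrightarrow> 0" "B v v \<le> c + \<epsilon>"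
    by blast
  have "AE x in \<mu>. x \<in> W n \<longrightarrow> 1 \<le> v x" for n
  proof (rule closed_ge_1[OF _ sv(2,3) W(2), of n])
    show "s k \<in> V" for k using sv(1)[of k] C_def by simp
    show "AE x in \<mu>. x \<in> W n \<longrightarrow> 1 \<le> s k x" if "n \<le> k" for k
    proof -
      have "W n \<subseteq> W k" unfolding W_def using that by fastforce
      then show ?thesis using sv(1)[of k] unfolding C_def by (auto elim!: eventually_mono)
    qed
  qed
  then have "AE x in \<mu>. \<forall>n. x \<in> W n \<longrightarrow> 1 \<le> v x"
    using AE_all_countable[of "\<lambda>n x. x \<in> W n \<longrightarrow> 1 \<le> v x" \<mu>] by blast
  then have "AE x in \<mu>. x \<in> (\<Union>n. W n) \<longrightarrow> 1 \<le> v x" by eventually_elim auto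
  moreover have "(\<Union>n. A n) \<subseteq> (\<Union>n. W n)" unfolding W_def using U(2) by blast
  ultimately have "capacity (\<Union>n. A n) \<le> ennreal (B v v)"
    using open_UN[of UNIV W] W(1) cap_le[OF sv(2)] by blast
  also have "\<dots> \<le> ennreal c + ennreal \<epsilon>"
    using sv(4) assms(3) \<epsilon> by (simp add: ennreal_leI flip: ennreal_plus)
  finally show "capacity (\<Union>n. A n) \<le> ennreal c + ennreal \<epsilon>" .
qed

text \<open>By compactness, an open neighborhood of the whole intersection contains a finite partial
  one, so each competitor for the former is one for the latter.\<close>

lemma cap_compact_Inter:
  fixes C :: "nat \<Rightarrow> 'a set"
  assumes "\<And>n. compact (C n)" "\<And>n. c \<le> capacity (\<Inter>i\<le>n. C i)"
  shows "c \<le> capacity (\<Inter>n. C n)"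
  unfolding cap_def[of _ _ _ "\<Inter>n. C n"]
proof (rule Inf_greatest, clarify)
  fix u U assume U: "u \<in> V" "open U" "(\<Inter>n. C n) \<subseteq> U" "AE x in \<mu>. x \<in> U \<longrightarrow> 1 \<le> u x"
  have "compact (C 0 - U)" using assms(1) U(2) by (rule compact_diff)
  moreover have "C 0 - U \<subseteq> (\<Union>n\<in>UNIV. - C n)" using U(3) by blast
  moreover have "open (- C n)" for n using compact_imp_closed[OF assms(1)] by auto
  ultimately obtain I where I: "finite I" "C 0 - U \<subseteq> (\<Union>n\<in>I. - C n)"
    using compactE_image[of "C 0 - U" UNIV "\<lambda>n. - C n"] by auto
  define n where "n = Max (insert 0 I)"
  have "i \<le> n" if "i \<in> I" for i unfolding n_def using I(1) that by simp
  then have "(\<Inter>i\<le>n. C i) \<subseteq> U" using I(2) by blast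
  then have "capacity (\<Inter>i\<le>n. C i) \<le> ennreal (B u u)" by (rule cap_le[OF U(1,2) _ U(4)])
  then show "c \<le> ennreal (B u u)" using assms(2) order_trans by blast
qed

text \<open>Choquet's capacitability argument, which for \<open>G\<^sub>\<delta>\<close> sets needs no Souslin operation.\<close>
lemma compact_null_set_positive_cap:
  assumes "\<And>K. compact K \<Longrightarrow> emeasure \<mu> K < \<infinity>" "compact_exhaustion (Q :: nat \<Rightarrow> 'a set)"
    and A: "A \<in> sets \<mu>" "emeasure \<mu> A = 0" "capacity A > 0"
  shows "\<exists>K. compact K \<and> emeasure \<mu> K = 0 \<and> capacity K > 0"
proof -
  obtain G where G: "\<And>n::nat. open (G n)" "A \<subseteq> (\<Inter>n. G n)" "emeasure \<mu> (\<Inter>n. G n) = 0"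
    using null_set_in_null_Gdelta[OF borel assms(1,2) _ A(2)] A(1) borel by auto
  obtain c where c: "ennreal c < capacity A" "c > 0" using ennreal_pos_below[OF A(3)] by blast
  \<comment> \<open>Each step cuts the current set by a compact part of \<open>G n\<close>. The sets
    \<open>f n\<close> need not be compact; they only certify that the finite intersections of the
    compact parts have capacity above \<open>c\<close>.\<close>
  have "\<exists>f. \<forall>n::nat. (f n \<subseteq> (\<Inter>n. G n) \<and> ennreal c < capacity (f n)) \<and>
      (\<exists>C. compact C \<and> C \<subseteq> G n \<and> f (Suc n) = f n \<inter> C)"
  proof (rule dependent_nat_choice)
    show "\<exists>S. S \<subseteq> (\<Inter>n. G n) \<and> ennreal c < capacity S" using G(2) c by blast
    fix S n assume S: "S \<subseteq> (\<Inter>n. G n) \<and> ennreal c < capacity S"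
    obtain C where C: "incseq C" "\<And>k::nat. compact (C k)" "(\<Union>k. C k) = G n"
      using open_compact_exhaustion[OF assms(2) G(1)] by blast
    \<comment> \<open>The sets \<open>S \<inter> C k\<close> increase to \<open>S\<close> because
      \<open>S\<close> lies in \<open>G n\<close>, so continuity along increasing sequences
      preserves the strict bound at some \<open>k\<close>.\<close>
    have "\<exists>k. ennreal c < capacity (S \<inter> C k)"
    proof (rule ccontr)
      assume "\<not> ?thesis"
      then have "capacity (\<Union>k. S \<inter> C k) \<le> ennreal c"
        using C(1) c(2) by (intro cap_increasing_union) (auto simp: incseq_def not_less)
      moreover have "(\<Union>k. S \<inter> C k) = S" using C(3) S by blast
      ultimately show False using S by (metis not_less)
    qed
    then obtain k where "ennreal c < capacity (S \<inter> C k)" by blast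
    then show "\<exists>S'. (S' \<subseteq> (\<Inter>n. G n) \<and> ennreal c < capacity S') \<and>
        (\<exists>C. compact C \<and> C \<subseteq> G n \<and> S' = S \<inter> C)"
      using S C(2)[of k] C(3) by (intro exI[of _ "S \<inter> C k"]) auto
  qed
  then obtain f where f: "\<And>n. ennreal c < capacity (f n)"
      "\<And>n. \<exists>C. compact C \<and> C \<subseteq> G n \<and> f (Suc n) = f n \<inter> C" by blast
  then obtain C where C: "\<And>n. compact (C n)" "\<And>n. C n \<subseteq> G n" "\<And>n. f (Suc n) = f n \<inter> C n"
    by metis
  have fC: "f (Suc n) \<subseteq> (\<Inter>i\<le>n. C i)" for n
  proof (induction n)
    case (Suc n)
    then show ?case unfolding C(3)[of "Suc n"] atMost_Suc by blast
  qed (use C(3)[of 0] in auto)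
  have "ennreal c \<le> capacity (\<Inter>i\<le>n. C i)" for n
    using f(1)[of "Suc n"] cap_mono[OF fC[of n]] by simp
  then have "ennreal c \<le> capacity (\<Inter>n. C n)" using C(1) by (intro cap_compact_Inter)
  then have "0 < capacity (\<Inter>n. C n)"
    using less_le_trans[of 0 "ennreal c"] c(2) by simp
  moreover have "compact (\<Inter>n. C n)"
  proof -
    have "closed (\<Inter>n. C n)" using C(1) compact_imp_closed by (intro closed_INT) blast
    then have "compact (C 0 \<inter> (\<Inter>n. C n))" by (rule compact_Int_closed[OF C(1)])
    moreover have "C 0 \<inter> (\<Inter>n. C n) = (\<Inter>n. C n)" by blast
    ultimately show ?thesis by simp
  qed
  moreover have "emeasure \<mu> (\<Inter>n. C n) = 0"
  proof -
    have "(\<Inter>n. G n) \<in> sets \<mu>" using G(1) borel by auto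
    then have "emeasure \<mu> (\<Inter>n. C n) \<le> emeasure \<mu> (\<Inter>n. G n)"
      using INF_mono'[of C G UNIV, OF C(2)] by (intro emeasure_mono)
    then show ?thesis using G(3) by simp
  qed
  ultimately show ?thesis by blast
qed

end

section \<open>Capacitary potentials\<close>

text \<open>Boundedness turns the real-valued \<open>SUP\<close> in the regularity condition into a
  genuine pointwise bound.\<close>

lemma Cc_bounded:
  fixes f :: "'a::metric_space \<Rightarrow> real"
  assumes "f \<in> Cc_space"
  shows "\<exists>b. \<forall>x. \<bar>f x\<bar> \<le> b"
proof -
  have "continuous_on (closure {x. f x \<noteq> 0}) f" "compact (closure {x. f x \<noteq> 0})"
    using assms continuous_on_subset unfolding Cc_space_def by auto
  then have "bounded (f ` closure {x. f x \<noteq> 0})"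
    by (intro compact_imp_bounded compact_continuous_image)
  then obtain b where b: "\<forall>y\<in>f ` closure {x. f x \<noteq> 0}. \<bar>y\<bar> \<le> b"
    unfolding bounded_iff real_norm_def by blast
  have "\<bar>f x\<bar> \<le> max b 0" for x
  proof (cases "f x = 0")
    case False
    then have "x \<in> closure {x. f x \<noteq> 0}" using closure_subset[of "{x. f x \<noteq> 0}"] by auto
    then have "\<bar>f x\<bar> \<le> b" using b by blast
    then show ?thesis by simp
  qed simp
  then show ?thesis by blast
qed

text \<open>The level 3/2 leaves a margin for replacing the bump by an element of \<open>V\<close>
  at uniform distance below 1/4.\<close>

lemma compact_bump:
  fixes K U :: "'a::metric_space set"
  assumes "compact K" "open U" "K \<subseteq> U" "compact_exhaustion (Q :: nat \<Rightarrow> 'a set)"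
  shows "\<exists>f W. f \<in> Cc_space \<and> open W \<and> K \<subseteq> W \<and> (\<forall>x\<in>W. 3/2 \<le> f x) \<and> (\<forall>x. x \<notin> U \<longrightarrow> f x = 0)"
proof (cases "K = {}")
  case True
  \<comment> \<open>Separate because \<open>infdist\<close> to the empty set is 0, so the formula
    below would yield the constant 2.\<close>
  then show ?thesis by (intro exI[of _ "\<lambda>_. 0"] exI[of _ "{}"]) (simp add: Cc_space_def)
next
  case False
  obtain n where n: "K \<subseteq> interior (Q n)" using compact_subset_exhaustion assms by blast
  have Qc: "compact (Q n)" using assms(4) unfolding compact_exhaustion_def by blast
  \<comment> \<open>Staying inside some \<open>Q n\<close> makes the support compact.\<close>
  define O' where "O' = U \<inter> interior (Q n)"
  have "open O'" "K \<subseteq> O'" unfolding O'_def using assms n by auto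
  then obtain e where e: "e > 0" "(\<Union>x\<in>K. ball x e) \<subseteq> O'"
    using compact_subset_open_imp_ball_epsilon_subset[OF assms(1)] by blast
  have near: "x \<in> O'" if x: "infdist x K < e" for x
  proof -
    have "(INF a\<in>K. dist x a) < e" using x False by (simp add: infdist_notempty)
    then obtain a where "a \<in> K" "dist x a < e"
      using cINF_less_iff[OF False bdd_belowI2[of K 0 "dist x"]] by auto
    then have "x \<in> ball a e" "a \<in> K" by (auto simp: dist_commute)
    then show ?thesis using e(2) by blast
  qed
  \<comment> \<open>The slope makes \<open>f\<close> vanish at distance \<open>e / 2\<close>, safely
    inside the \<open>e\<close>-neighborhood, and keeps it above 3/2 up to distance
    \<open>e / 8\<close>.\<close>
  define f where "f x = max 0 (2 - 4 * infdist x K / e)" for x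
  have cont: "continuous_on UNIV f"
    unfolding f_def using e(1) by (intro continuous_intros) auto
  have cl: "closed {x. infdist x K \<le> e / 2}"
    by (intro closed_Collect_le continuous_intros)
  have "{x. f x \<noteq> 0} \<subseteq> {x. infdist x K \<le> e / 2}"
    using e(1) by (auto simp: f_def max_def field_simps)
  then have sub: "closure {x. f x \<noteq> 0} \<subseteq> {x. infdist x K \<le> e / 2}"
    using cl by (rule closure_minimal)
  have "{x. infdist x K \<le> e / 2} \<subseteq> O'"
  proof
    fix x assume "x \<in> {x. infdist x K \<le> e / 2}"
    then have "infdist x K < e" using e(1) by simp
    then show "x \<in> O'" by (rule near)
  qed
  then have "closure {x. f x \<noteq> 0} \<subseteq> Q n"
    using sub interior_subset unfolding O'_def by blast
  then have "compact (closure {x. f x \<noteq> 0})"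
    using closed_Int_compact[OF closed_closure Qc, of "{x. f x \<noteq> 0}"] by (simp add: Int_absorb2)
  then have f: "f \<in> Cc_space" using cont by (simp add: Cc_space_def)
  have "open {x. infdist x K < e / 8}" by (intro open_Collect_less continuous_intros)
  moreover have "K \<subseteq> {x. infdist x K < e / 8}" using e(1) by auto
  moreover have "\<forall>x\<in>{x. infdist x K < e / 8}. 3/2 \<le> f x"
    using e(1) by (auto simp: f_def field_simps)
  moreover have "f x = 0" if "x \<notin> U" for x
  proof -
    have "\<not> infdist x K < e" using near that unfolding O'_def by blast
    then have "4 \<le> 4 * infdist x K / e" using e(1) by (simp add: field_simps)
    then show ?thesis by (simp add: f_def)
  qed
  ultimately show ?thesis using f by blast
qed

context dirichlet
begin

lemma compact_bump_in_V:
  fixes K U :: "'a::metric_space set"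
  assumes "compact K" "open U" "K \<subseteq> U" "compact_exhaustion (Q :: nat \<Rightarrow> 'a set)"
    and reg: "\<And>f e. f \<in> Cc_space \<Longrightarrow> e > 0 \<Longrightarrow> \<exists>w\<in>V \<inter> Cc_space. (SUP x. \<bar>f x - w x\<bar>) < e"
  shows "\<exists>\<phi> W. \<phi> \<in> V \<and> open W \<and> K \<subseteq> W \<and> (\<forall>x\<in>W. 1 \<le> \<phi> x) \<and> (\<forall>x. x \<notin> U \<longrightarrow> \<phi> x = 0)"
proof -
  obtain f W where f: "f \<in> Cc_space" "open W" "K \<subseteq> W" "\<forall>x\<in>W. 3/2 \<le> f x" "\<forall>x. x \<notin> U \<longrightarrow> f x = 0"
    using compact_bump[OF assms(1-4)] by blast
  obtain w where w: "w \<in> V" "w \<in> Cc_space" "(SUP x. \<bar>f x - w x\<bar>) < 1/4"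
    using reg[OF f(1), of "1/4"] by auto
  obtain b c where bc: "\<forall>x. \<bar>f x\<bar> \<le> b" "\<forall>x. \<bar>w x\<bar> \<le> c" using Cc_bounded f(1) w(2) by blast
  have "\<bar>f x - w x\<bar> \<le> b + c" for x using bc[rule_format, of x] by linarith
  then have "bdd_above (range (\<lambda>x. \<bar>f x - w x\<bar>))" by (intro bdd_aboveI2)
  then have "\<bar>f x - w x\<bar> \<le> (SUP x. \<bar>f x - w x\<bar>)" for x by (rule cSUP_upper[OF UNIV_I])
  then have near: "\<bar>f x - w x\<bar> < 1/4" for x using w(3) le_less_trans by blast
  \<comment> \<open>Uniform approximation only gives values at most 1/4 outside \<open>U\<close>;
    cutting them off restores exact vanishing and leaves at least 5/4 - 1/4 = 1 on
    \<open>W\<close>.\<close>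
  define \<phi> where "\<phi> = trunc 2 w - trunc (1/4) w"
  have "\<phi> \<in> V" unfolding \<phi>_def using trunc_mem[OF w(1)] by (intro mem) auto
  moreover have "1 \<le> \<phi> x" if "x \<in> W" for x
  proof -
    have "3/2 \<le> f x" using f(4) that by blast
    then have "5/4 \<le> w x" using near[of x] by linarith
    then show ?thesis by (simp add: \<phi>_def trunc_def)
  qed
  moreover have "\<phi> x = 0" if "x \<notin> U" for x
  proof -
    have "f x = 0" using f(5) that by blast
    then have "w x \<le> 1/4" using near[of x] by linarith
    then show ?thesis by (simp add: \<phi>_def trunc_def)
  qed
  ultimately show ?thesis using f(2,3) by blast
qed

text \<open>\<open>f\<close> is the element of least energy in the closure of the set
  \<open>S\<close> of competitors for the capacity of \<open>K\<close>. Adding to a competitor a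
  function that vanishes near \<open>K\<close>, or a nonnegative one, gives a competitor again; the
  variational inequality turns these stabilities into the two sign properties.\<close>

lemma capacitary_potential:
  assumes K: "capacity K > 0"
    and \<phi>: "\<phi> \<in> V" "open W" "K \<subseteq> W" "\<And>x. x \<in> W \<Longrightarrow> 1 \<le> \<phi> x"
  shows "\<exists>f\<in>V. (\<forall>z O'. z \<in> V \<longrightarrow> open O' \<longrightarrow> K \<subseteq> O' \<longrightarrow> (AE x in \<mu>. x \<in> O' \<longrightarrow> z x = 0) \<longrightarrow> B f z = 0) \<and>
    (\<forall>z\<in>V. (AE x in \<mu>. 0 \<le> z x) \<longrightarrow> 0 \<le> B f z) \<and> 0 < B f \<phi>"
proof -
  define S where "S = {u\<in>V. \<exists>O'. open O' \<and> K \<subseteq> O' \<and> (AE x in \<mu>. x \<in> O' \<longrightarrow> 1 \<le> u x)}"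
  have S_I: "u \<in> S" if "u \<in> V" "open O'" "K \<subseteq> O'" "AE x in \<mu>. x \<in> O' \<longrightarrow> 1 \<le> u x" for u O'
    using that unfolding S_def by blast
  have S_E: "\<exists>O'. open O' \<and> K \<subseteq> O' \<and> (AE x in \<mu>. x \<in> O' \<longrightarrow> 1 \<le> u x)" and S_V: "u \<in> V" if "u \<in> S" for u
    using that unfolding S_def by blast+
  have conv: "convex S"
  proof (rule convexI)
    fix v w and s t :: real
    assume vw: "v \<in> S" "w \<in> S" and st: "0 \<le> s" "0 \<le> t" "s + t = 1"
    obtain P where P: "open P" "K \<subseteq> P" "AE x in \<mu>. x \<in> P \<longrightarrow> 1 \<le> v x" using S_E[OF vw(1)] by blast
    obtain R where R: "open R" "K \<subseteq> R" "AE x in \<mu>. x \<in> R \<longrightarrow> 1 \<le> w x" using S_E[OF vw(2)] by blast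
    have ae: "AE x in \<mu>. x \<in> P \<inter> R \<longrightarrow> 1 \<le> (s *\<^sub>R v + t *\<^sub>R w) x"
      using P(3) R(3)
    proof eventually_elim
      case (elim x)
      show ?case
      proof
        assume "x \<in> P \<inter> R"
        then have "s * 1 + t * 1 \<le> s * v x + t * w x"
          using elim st by (intro add_mono mult_left_mono) auto
        then show "1 \<le> (s *\<^sub>R v + t *\<^sub>R w) x" using st by (simp add: scaleR_fun_def)
      qed
    qed
    have "s *\<^sub>R v + t *\<^sub>R w \<in> V" by (intro mem S_V vw)
    then show "s *\<^sub>R v + t *\<^sub>R w \<in> S"
      by (rule S_I[OF _ open_Int[OF P(1) R(1)] Int_greatest[OF P(2) R(2)] ae])
  qed
  have \<phi>S: "\<phi> \<in> S" using \<phi> by (intro S_I[of _ W]) auto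
  have SV: "S \<subseteq> V" "S \<noteq> {}" using S_V \<phi>S by auto
  have "\<exists>s v. (\<forall>n::nat. s n \<in> S) \<and> v \<in> V \<and> (\<lambda>n. nrm (s n - v)) \<longlonglongrightarrow> 0 \<and>
    (\<forall>x\<in>S. 0 \<le> B v (x - v))"
    by (rule variational_inequality[OF zero_functional _ SV(1) conv SV(2), of 0]) simp
  then obtain s f where s: "\<And>n. s n \<in> S" "f \<in> V" "(\<lambda>n. nrm (s n - f)) \<longlonglongrightarrow> 0"
    and vi: "\<And>x. x \<in> S \<Longrightarrow> 0 \<le> B f (x - f)" by blast
  have sV: "s n \<in> V" for n using s(1) S_V by blast
  have pos: "B f f > 0"
  proof -
    obtain c where c: "c > 0" "ennreal c < capacity K" using ennreal_pos_below[OF K] by blast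
    have "c \<le> B (s n) (s n)" for n
    proof -
      obtain P where P: "open P" "K \<subseteq> P" "AE x in \<mu>. x \<in> P \<longrightarrow> 1 \<le> s n x" using S_E[OF s(1)] by blast
      have "ennreal c \<le> ennreal (B (s n) (s n))"
        using c(2) cap_le[OF sV P] by simp
      then show ?thesis using nonneg[OF sV] by simp
    qed
    then have "c \<le> B f f" using LIMSEQ_le_const[OF diagonal_tendsto[OF sV s(2,3)]] by blast
    then show ?thesis using c by simp
  qed
  have lim: "(\<lambda>n. B f (s n)) \<longlonglongrightarrow> B f f" by (rule right_tendsto[OF s(2) sV s(2,3)])
  \<comment> \<open>\<open>f\<close> may fail to be a competitor itself, so \<open>z\<close> is
    added to the approximating \<open>s n\<close>.\<close>
  have step: "0 \<le> B f z" if z: "z \<in> V" "\<And>n. s n + z \<in> S" for z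
  proof -
    have "0 \<le> B f (s n) + B f z - B f f" for n
      using vi[OF z(2)[of n]] s(2) sV z(1) by (simp add: expand mem)
    moreover have "(\<lambda>n. B f (s n) + B f z - B f f) \<longlonglongrightarrow> B f f + B f z - B f f"
      by (intro tendsto_intros lim)
    ultimately have "0 \<le> B f f + B f z - B f f" using LIMSEQ_le_const by blast
    then show ?thesis by simp
  qed
  have add_near: "s n + c *\<^sub>R z \<in> S" if z: "z \<in> V" "open O'" "K \<subseteq> O'" "AE x in \<mu>. x \<in> O' \<longrightarrow> z x = 0"
    for z O' n and c :: real
  proof -
    obtain P where P: "open P" "K \<subseteq> P" "AE x in \<mu>. x \<in> P \<longrightarrow> 1 \<le> s n x" using S_E[OF s(1)] by blast
    have ae: "AE x in \<mu>. x \<in> P \<inter> O' \<longrightarrow> 1 \<le> (s n + c *\<^sub>R z) x"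
      using P(3) z(4) by eventually_elim (auto simp: scaleR_fun_def)
    have "s n + c *\<^sub>R z \<in> V" by (intro mem sV z)
    then show ?thesis
      by (rule S_I[OF _ open_Int[OF P(1) z(2)] Int_greatest[OF P(2) z(3)] ae])
  qed
  have zero: "B f z = 0" if z: "z \<in> V" "open O'" "K \<subseteq> O'" "AE x in \<mu>. x \<in> O' \<longrightarrow> z x = 0" for z O'
  proof -
    have "0 \<le> B f (1 *\<^sub>R z)" "0 \<le> B f ((-1) *\<^sub>R z)"
      by (rule step[OF mem_scale[OF z(1)] add_near[OF z]])+
    then show ?thesis using expand(5)[OF z(1) z(1) s(2), of "-1"] by simp
  qed
  have nonneg_fun: "0 \<le> B f z" if z: "z \<in> V" "AE x in \<mu>. 0 \<le> z x" for z
  proof (rule step[OF z(1)])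
    fix n
    obtain P where P: "open P" "K \<subseteq> P" "AE x in \<mu>. x \<in> P \<longrightarrow> 1 \<le> s n x" using S_E[OF s(1)] by blast
    have ae: "AE x in \<mu>. x \<in> P \<longrightarrow> 1 \<le> (s n + z) x"
      using P(3) z(2) by eventually_elim auto
    show "s n + z \<in> S" by (rule S_I[OF mem_add[OF sV z(1)] P(1,2) ae])
  qed
  \<comment> \<open>\<open>\<phi>\<close> is a competitor, so \<open>B f \<phi>\<close> is at least
    the energy of \<open>f\<close>, which positive capacity keeps away from zero.\<close>
  have "0 \<le> B f \<phi> - B f f" using vi[OF \<phi>S] s(2) \<phi>(1) by (simp add: expand)
  then have "0 < B f \<phi>" using pos by simp
  then show ?thesis using s(2) zero nonneg_fun by blast
qed

text \<open>The function \<open>(min 1 \<bar>y\<bar> - e - \<epsilon>)\<^sup>+\<close> vanishes near \<open>K\<close> as soon as \<open>e \<ge> 1\<close> holds on an open set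
  of small capacity outside of which \<open>y\<close> is continuous and vanishes on \<open>K\<close>.\<close>
lemma potential_vanishes_on_quasi_zeros:
  assumes f: "f \<in> V"
    and zero: "\<And>z O'. z \<in> V \<Longrightarrow> open O' \<Longrightarrow> K \<subseteq> O' \<Longrightarrow> AE x in \<mu>. x \<in> O' \<longrightarrow> z x = 0 \<Longrightarrow> B f z = 0"
    and nonneg_f: "\<And>z. z \<in> V \<Longrightarrow> AE x in \<mu>. 0 \<le> z x \<Longrightarrow> 0 \<le> B f z"
    and y: "y \<in> V" "quasi_continuous \<mu> V E y" "capacity (K \<inter> {x. y x \<noteq> 0}) = 0"
  shows "B f (trunc 1 y + trunc 1 (- y)) = 0"
proof -
  define y' where "y' = trunc 1 y + trunc 1 (- y)"
  have y': "y' x = min 1 \<bar>y x\<bar>" for x by (auto simp: y'_def trunc_def)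
  have y'V: "y' \<in> V" unfolding y'_def using y(1) markov by (intro mem) (auto intro: mem)
  have truncV: "trunc c y' \<in> V" if "c > 0" for c using trunc_mem[OF y'V that] .
  \<comment> \<open>Pointwise, \<open>y'\<close> is at most
    \<open>trunc \<epsilon> y' + (e1 + e2) + z\<close>. Here \<open>B f\<close> annihilates
    \<open>z\<close>, and \<open>e1\<close>, \<open>e2\<close> have norm at most
    \<open>\<delta>\<close>; positivity of \<open>B f\<close> gives the bound.\<close>
  have est: "B f y' \<le> B f (trunc \<epsilon> y') + 2 * \<delta> * nrm f" if \<epsilon>: "0 < \<epsilon>" "\<epsilon> \<le> 1" and \<delta>: "0 < \<delta>" for \<epsilon> \<delta>
  proof -
    have d2: "\<delta>\<^sup>2 > 0" using \<delta> by simp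
    \<comment> \<open>Capacity is a squared norm, hence the bound by the square of
      \<open>\<delta>\<close>.\<close>
    obtain G where G: "open G" "capacity G < ennreal (\<delta>\<^sup>2)" "continuous_on (- G) y"
      using y(2) d2 unfolding quasi_continuous_def by blast
    obtain e1 U1 where e1: "open U1" "G \<subseteq> U1" "e1 \<in> V" "\<forall>x. 0 \<le> e1 x \<and> e1 x \<le> 1"
      "AE x in \<mu>. x \<in> U1 \<longrightarrow> 1 \<le> e1 x" "B e1 e1 < \<delta>\<^sup>2"
      using cap_less[OF G(2)] by blast
    have "capacity (K \<inter> {x. y x \<noteq> 0}) < ennreal (\<delta>\<^sup>2)" using y(3) d2 by simp
    from cap_less[OF this] obtain e2 U2 where e2: "open U2" "K \<inter> {x. y x \<noteq> 0} \<subseteq> U2" "e2 \<in> V"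
      "\<forall>x. 0 \<le> e2 x \<and> e2 x \<le> 1" "AE x in \<mu>. x \<in> U2 \<longrightarrow> 1 \<le> e2 x" "B e2 e2 < \<delta>\<^sup>2"
      by blast
    have nrm_e: "nrm e \<le> \<delta>" if "B e e < \<delta>\<^sup>2" for e
      using that \<delta> real_sqrt_less_mono[OF that] by (simp add: nrm_def)
    \<comment> \<open>Continuity of \<open>y\<close> is available only relative to the complement of
      \<open>G\<close>; \<open>T\<close> is an open set of the whole space with the right trace
      there.\<close>
    have "openin (top_of_set (- G)) (- G \<inter> y -` {-\<epsilon><..<\<epsilon>})"
      by (rule continuous_openin_preimage_gen[OF G(3)]) simp
    then obtain T where T: "open T" "- G \<inter> y -` {-\<epsilon><..<\<epsilon>} = - G \<inter> T"
      unfolding openin_open by blast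
    define u where "u = y' - (e1 + e2)"
    have uV: "u \<in> V" unfolding u_def using y'V e1(3) e2(3) by (intro mem)
    \<comment> \<open>This is the positive part of \<open>u - \<epsilon>\<close>, expressed by
      truncations to stay in \<open>V\<close>; the upper level 1 is harmless because
      \<open>u\<close> is at most \<open>y'\<close>, hence at most 1.\<close>
    define z where "z = trunc 1 u - trunc \<epsilon> u"
    have zV: "z \<in> V" unfolding z_def using \<epsilon>(1) trunc_mem[OF uV] by (intro mem) auto
    have u_eq: "u x = y' x - (e1 x + e2 x)" for x by (simp add: u_def)
    have "u x \<le> y' x" for x
      using e1(4)[rule_format, of x] e2(4)[rule_format, of x] u_eq[of x] by linarith
    moreover have "y' x \<le> 1" "0 \<le> y' x" for x by (simp_all add: y')
    ultimately have u_le: "u x \<le> y' x" "y' x \<le> 1" "0 \<le> y' x" for x by blast+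
    have z_pos: "z x = max 0 (u x - \<epsilon>)" for x
      using u_le[of x] \<epsilon> by (simp add: z_def trunc_def min_def max_def)
    have "B f z = 0"
    proof (rule zero[OF zV])
      show "open (T \<union> U1 \<union> U2)" using T e1 e2 by auto
      show "K \<subseteq> T \<union> U1 \<union> U2"
      proof
        fix x assume x: "x \<in> K"
        have "x \<in> T" if "x \<notin> G" "y x = 0"
        proof -
          have "x \<in> - G \<inter> y -` {-\<epsilon><..<\<epsilon>}" using that \<epsilon> by simp
          then show ?thesis using T(2) by blast
        qed
        then show "x \<in> T \<union> U1 \<union> U2" using x e1(2) e2(2) by blast
      qed
      show "AE x in \<mu>. x \<in> T \<union> U1 \<union> U2 \<longrightarrow> z x = 0"
        using e1(5) e2(5)
      proof eventually_elim
        case (elim x)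
        show ?case
        proof
          assume x: "x \<in> T \<union> U1 \<union> U2"
          have e0: "0 \<le> e1 x" "0 \<le> e2 x" using e1(4) e2(4) by auto
          have "u x \<le> \<epsilon>"
          proof (cases "x \<in> U1 \<union> U2")
            case True
            then have "1 \<le> e1 x + e2 x" using elim e0 by auto
            then show ?thesis using \<epsilon> u_le[of x] by (simp add: u_def)
          next
            case False
            then have "x \<in> - G \<inter> y -` {-\<epsilon><..<\<epsilon>}" using x T(2) e1(2) by blast
            then have "\<bar>y x\<bar> < \<epsilon>" by auto
            then show ?thesis using e0 by (simp add: u_def y')
          qed
          then show "z x = 0" by (simp add: z_pos)
        qed
      qed
    qed
    have "0 \<le> B f ((trunc \<epsilon> y' + (e1 + e2)) - (y' - z))"
    proof (rule nonneg_f)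
      show "(trunc \<epsilon> y' + (e1 + e2)) - (y' - z) \<in> V"
        using y'V zV e1(3) e2(3) truncV[OF \<epsilon>(1)] by (intro mem)
      have "0 \<le> ((trunc \<epsilon> y' + (e1 + e2)) - (y' - z)) x" for x
      proof -
        have "0 \<le> e1 x" "0 \<le> e2 x" using e1(4) e2(4) by auto
        then show ?thesis using u_le[of x] z_pos[of x] unfolding u_def by (auto simp: trunc_def)
      qed
      then show "AE x in \<mu>. 0 \<le> ((trunc \<epsilon> y' + (e1 + e2)) - (y' - z)) x" by simp
    qed
    also have "\<dots> = B f (trunc \<epsilon> y') + (B f e1 + B f e2) - (B f y' - B f z)"
      using f y'V zV e1(3) e2(3) truncV[OF \<epsilon>(1)] by (simp add: expand mem)
    finally have "B f y' \<le> B f (trunc \<epsilon> y') + B f e1 + B f e2" using \<open>B f z = 0\<close> by simp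
    moreover have fe: "B f e \<le> \<delta> * nrm f" if e: "e \<in> V" "B e e < \<delta>\<^sup>2" for e
    proof -
      have "B f e \<le> nrm f * nrm e" using cauchy_schwarz[OF f e(1)] by simp
      also have "\<dots> \<le> nrm f * \<delta>" using nrm_e[OF e(2)] nrm_nonneg[OF f] by (intro mult_left_mono)
      finally show ?thesis by (simp add: mult.commute)
    qed
    ultimately show ?thesis using fe[OF e1(3,6)] fe[OF e2(3,6)] by linarith
  qed
  have le: "B f y' \<le> B f (trunc \<epsilon> y')" if \<epsilon>: "0 < \<epsilon>" "\<epsilon> \<le> 1" for \<epsilon>
  proof -
    have "((\<lambda>\<delta>. B f (trunc \<epsilon> y') + 2 * \<delta> * nrm f) \<longlongrightarrow> B f (trunc \<epsilon> y') + 2 * 0 * nrm f) (at_right 0)"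
      by (intro tendsto_intros)
    moreover have "\<forall>\<^sub>F \<delta> in at_right 0. B f y' \<le> B f (trunc \<epsilon> y') + 2 * \<delta> * nrm f"
      using est[OF \<epsilon>] by (auto simp: eventually_at_right_field intro!: exI[of _ 1])
    ultimately have "B f y' \<le> B f (trunc \<epsilon> y') + 2 * 0 * nrm f"
      by (rule tendsto_lowerbound[OF _ _ trivial_limit_at_right_real])
    then show ?thesis by simp
  qed
  have eq: "B f (trunc \<epsilon> y') = B f y'" if \<epsilon>: "0 < \<epsilon>" "\<epsilon> \<le> 1" for \<epsilon>
  proof -
    have "0 \<le> B f (y' - trunc \<epsilon> y')"
      using y'V truncV[OF \<epsilon>(1)] by (intro nonneg_f mem) (auto simp: trunc_def y')
    then show ?thesis using le[OF \<epsilon>] f y'V truncV[OF \<epsilon>(1)] by (simp add: expand)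
  qed
  \<comment> \<open>By \<open>eq\<close>, \<open>B f\<close> takes the same value on all these
    truncations. Their energies stay below that of \<open>y'\<close> while their L2 norms tend to
    zero, so this value is 0.\<close>
  define m where "m n = trunc (1 / real (Suc n)) y'" for n
  have mV: "m n \<in> V" for n unfolding m_def using truncV by simp
  have m0: "0 \<le> m n x" "m n x \<le> y' x" "m n x \<le> 1 / real (Suc n)" for n x
    by (auto simp: m_def trunc_def y')
  have mdec: "m n x \<le> m k x" if "k \<le> n" for n k x
  proof -
    have "1 / real (Suc n) \<le> 1 / real (Suc k)" using that by (intro divide_left_mono) auto
    then show ?thesis by (auto simp: m_def trunc_def)
  qed
  have "B f y' = 0"
  proof (rule weak_limit_zero[OF linear_right[OF f] cauchy_schwarz[OF f] mV])
    show "B (m n) (m n) \<le> B y' y'" for n unfolding m_def using trunc_contract[OF y'V] by simp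
    show "B f (m n) = B f y'" for n unfolding m_def using eq by simp
    show "(\<integral>x. (m n x)\<^sup>2 \<partial>\<mu>) \<le> (\<integral>x. (m n x)\<^sup>2 \<partial>\<mu>)" for n by simp
    show "decseq (\<lambda>n. \<integral>x. (m n x)\<^sup>2 \<partial>\<mu>)"
      unfolding decseq_def using mdec m0 integrable_square[OF mV]
      by (intro allI impI integral_mono power_mono) auto
    have "(\<lambda>n. \<integral>x. (m n x)\<^sup>2 \<partial>\<mu>) \<longlonglongrightarrow> (\<integral>x. 0 \<partial>\<mu>)"
    proof (rule integral_dominated_convergence[where w = "\<lambda>x. (y' x)\<^sup>2"])
      show "integrable \<mu> (\<lambda>x. (y' x)\<^sup>2)" by (rule integrable_square[OF y'V])
      show "(\<lambda>x. (m n x)\<^sup>2) \<in> borel_measurable \<mu>" for n using measurable_V[OF mV] by simp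
      show "AE x in \<mu>. norm ((m n x)\<^sup>2) \<le> (y' x)\<^sup>2" for n
        using m0 by (intro AE_I2) (auto intro: power_mono)
      have "(\<lambda>n. (m n x)\<^sup>2) \<longlonglongrightarrow> 0" for x
      proof -
        have "(\<lambda>n. inverse (real (Suc n))) \<longlonglongrightarrow> 0" by (rule LIMSEQ_inverse_real_of_nat)
        then have "(\<lambda>n. m n x) \<longlonglongrightarrow> 0"
          using m0 by (intro real_tendsto_sandwich[OF _ _ tendsto_const, of 0 "\<lambda>n. m n x" _ "\<lambda>n. inverse (real (Suc n))"])
            (auto simp: divide_inverse)
        then have "(\<lambda>n. (m n x)\<^sup>2) \<longlonglongrightarrow> 0\<^sup>2" by (intro tendsto_intros)
        then show ?thesis by simp
      qed
      then show "AE x in \<mu>. (\<lambda>n. (m n x)\<^sup>2) \<longlonglongrightarrow> 0" by simp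
    qed simp
    then show "(\<lambda>n. \<integral>x. (m n x)\<^sup>2 \<partial>\<mu>) \<longlonglongrightarrow> 0" by simp
  qed
  then show ?thesis unfolding y'_def .
qed

end

section \<open>Dual spaces and positive functionals\<close>

context semi_hilbert
begin

lemma dual_space_subspace: "subspace (dual_space V nrm)"
proof (rule subspaceI)
  show "0 \<in> dual_space V nrm"
    unfolding dual_space_def linear_functional_on_def by (auto intro: exI[of _ 0])
next
  fix \<phi> \<psi> assume "\<phi> \<in> dual_space V nrm" "\<psi> \<in> dual_space V nrm"
  then obtain C D where \<phi>: "linear_functional_on V \<phi>" "\<forall>u\<in>V. \<bar>\<phi> u\<bar> \<le> C * nrm u" "\<forall>u. u \<notin> V \<longrightarrow> \<phi> u = 0"
    and \<psi>: "linear_functional_on V \<psi>" "\<forall>u\<in>V. \<bar>\<psi> u\<bar> \<le> D * nrm u" "\<forall>u. u \<notin> V \<longrightarrow> \<psi> u = 0"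
    unfolding dual_space_def by blast
  have "\<bar>(\<phi> + \<psi>) u\<bar> \<le> (C + D) * nrm u" if "u \<in> V" for u
  proof -
    have "\<bar>\<phi> u\<bar> \<le> C * nrm u" "\<bar>\<psi> u\<bar> \<le> D * nrm u" using \<phi>(2) \<psi>(2) that by blast+
    then show ?thesis by (simp add: algebra_simps)
  qed
  moreover have "linear_functional_on V (\<phi> + \<psi>)"
    using \<phi>(1) \<psi>(1) unfolding linear_functional_on_def by (simp add: algebra_simps)
  ultimately show "\<phi> + \<psi> \<in> dual_space V nrm"
    using \<phi>(3) \<psi>(3) unfolding dual_space_def by auto
next
  fix c and \<phi> assume "\<phi> \<in> dual_space V nrm"
  then obtain C where \<phi>: "linear_functional_on V \<phi>" "\<forall>u\<in>V. \<bar>\<phi> u\<bar> \<le> C * nrm u" "\<forall>u. u \<notin> V \<longrightarrow> \<phi> u = 0"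
    unfolding dual_space_def by blast
  have "\<bar>(c *\<^sub>R \<phi>) u\<bar> \<le> (\<bar>c\<bar> * C) * nrm u" if "u \<in> V" for u
    using \<phi>(2) that mult_left_mono[of "\<bar>\<phi> u\<bar>" "C * nrm u" "\<bar>c\<bar>"] by (simp add: scaleR_fun_def abs_mult mult.assoc)
  moreover have "linear_functional_on V (c *\<^sub>R \<phi>)"
    using \<phi>(1) unfolding linear_functional_on_def by (simp add: scaleR_fun_def algebra_simps)
  ultimately show "c *\<^sub>R \<phi> \<in> dual_space V nrm"
    using \<phi>(3) unfolding dual_space_def by (auto simp: scaleR_fun_def)
qed

lemma dual_bound:
  assumes "\<phi> \<in> dual_space V nrm" "u \<in> V"
  shows "\<bar>\<phi> u\<bar> \<le> dual_norm V nrm \<phi> * nrm u"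
proof -
  obtain C where C: "\<forall>u\<in>V. \<bar>\<phi> u\<bar> \<le> C * nrm u" and lin: "linear_functional_on V \<phi>"
    using assms(1) unfolding dual_space_def by blast
  show ?thesis
  proof (cases "nrm u = 0")
    case True
    \<comment> \<open>For a nonzero \<open>u\<close> of seminorm zero normalization is impossible,
      but the bound of \<open>\<phi>\<close> forces the value 0.\<close>
    then show ?thesis using C assms(2) by force
  next
    case False
    then have pos: "nrm u > 0" using nrm_nonneg[OF assms(2)] by simp
    have "\<bar>\<phi> v\<bar> \<le> \<bar>C\<bar>" if v: "v \<in> V" "nrm v \<le> 1" for v
    proof -
      have "\<bar>\<phi> v\<bar> \<le> C * nrm v" using C v by blast
      also have "\<dots> \<le> \<bar>C\<bar> * 1" using v nrm_nonneg[OF v(1)] by (intro mult_mono) auto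
      finally show ?thesis by simp
    qed
    then have bdd: "bdd_above ((\<lambda>v. \<bar>\<phi> v\<bar>) ` {v\<in>V. nrm v \<le> 1})" by (intro bdd_aboveI2[of _ _ "\<bar>C\<bar>"]) auto
    have "(1 / nrm u) *\<^sub>R u \<in> {v\<in>V. nrm v \<le> 1}"
      using nrm_scale[OF assms(2), of "1 / nrm u"] mem_scale[OF assms(2)] pos by simp
    then have "\<bar>\<phi> ((1 / nrm u) *\<^sub>R u)\<bar> \<le> dual_norm V nrm \<phi>"
      unfolding dual_norm_def by (rule cSUP_upper[OF _ bdd])
    moreover have "\<phi> ((1 / nrm u) *\<^sub>R u) = (1 / nrm u) * \<phi> u"
      using lin assms(2) unfolding linear_functional_on_def by blast
    ultimately show ?thesis using pos by (simp add: abs_mult field_simps)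
  qed
qed

lemma dual_norm_le:
  assumes "\<And>u. u \<in> V \<Longrightarrow> \<bar>\<phi> u\<bar> \<le> c * nrm u" "0 \<le> c"
  shows "dual_norm V nrm \<phi> \<le> c"
  unfolding dual_norm_def
proof (rule cSUP_least)
  have "nrm 0 = 0" using nrm_scale[OF mem_zero, of 0] by simp
  then show "{u \<in> V. nrm u \<le> 1} \<noteq> {}" using mem_zero by force
  fix u assume u: "u \<in> {u \<in> V. nrm u \<le> 1}"
  then have "\<bar>\<phi> u\<bar> \<le> c * nrm u" using assms(1) by blast
  also have "\<dots> \<le> c * 1" using u assms(2) by (intro mult_left_mono) auto
  finally show "\<bar>\<phi> u\<bar> \<le> c" by simp
qed

lemma dual_space_I:
  assumes "linear_functional_on V \<phi>" "\<And>u. u \<in> V \<Longrightarrow> \<bar>\<phi> u\<bar> \<le> c * nrm u"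
  shows "(\<lambda>u. if u \<in> V then \<phi> u else 0) \<in> dual_space V nrm"
  using assms unfolding dual_space_def linear_functional_on_def
  by (auto simp: mem intro!: exI[of _ c])

end

locale dirichlet_L1 = dirichlet +
  fixes c1 :: real
  assumes integrable_V: "u \<in> V \<Longrightarrow> integrable \<mu> u"
    and L1_bound: "u \<in> V \<Longrightarrow> L1_norm \<mu> u \<le> c1 * nrm u"
begin

lemma AE_bounded_mult:
  assumes "v \<in> borel_measurable \<mu>" "AE x in \<mu>. \<bar>v x\<bar> \<le> C" "u \<in> V"
  shows "integrable \<mu> (\<lambda>x. v x * u x)" "\<bar>\<integral>x. v x * u x \<partial>\<mu>\<bar> \<le> (\<bar>C\<bar> * c1) * nrm u"
proof -
  have le: "AE x in \<mu>. norm (v x * u x) \<le> norm (\<bar>C\<bar> * \<bar>u x\<bar>)"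
    using assms(2) by eventually_elim (auto simp: abs_mult intro: mult_right_mono)
  have int: "integrable \<mu> (\<lambda>x. \<bar>C\<bar> * \<bar>u x\<bar>)" using integrable_V[OF assms(3)] by simp
  show 1: "integrable \<mu> (\<lambda>x. v x * u x)"
    using assms(1) measurable_V[OF assms(3)] by (intro Bochner_Integration.integrable_bound[OF int _ le]) simp
  have "\<bar>\<integral>x. v x * u x \<partial>\<mu>\<bar> \<le> (\<integral>x. \<bar>v x * u x\<bar> \<partial>\<mu>)" by (rule integral_abs_bound)
  also have "\<dots> \<le> (\<integral>x. \<bar>C\<bar> * \<bar>u x\<bar> \<partial>\<mu>)"
    using le 1 int by (intro integral_mono_AE) auto
  also have "\<dots> = \<bar>C\<bar> * L1_norm \<mu> u" by (simp add: L1_norm_def)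
  also have "\<dots> \<le> \<bar>C\<bar> * (c1 * nrm u)" using L1_bound[OF assms(3)] by (intro mult_left_mono) auto
  finally show "\<bar>\<integral>x. v x * u x \<partial>\<mu>\<bar> \<le> (\<bar>C\<bar> * c1) * nrm u" by (simp add: mult.assoc)
qed

lemma integral_linear_functional:
  assumes "v \<in> borel_measurable \<mu>" "AE x in \<mu>. \<bar>v x\<bar> \<le> C"
  shows "linear_functional_on V (\<lambda>u. \<integral>x. v x * u x \<partial>\<mu>)"
  unfolding linear_functional_on_def
  using AE_bounded_mult(1)[OF assms] by (auto simp: distrib_left scaleR_fun_def mult.left_commute)

lemma dual_embedding_mem:
  assumes "v \<in> Linf_space \<mu>"
  shows "dual_embedding \<mu> V v \<in> dual_space V nrm"
proof -
  obtain C where "v \<in> borel_measurable \<mu>" "AE x in \<mu>. \<bar>v x\<bar> \<le> C"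
    using assms unfolding Linf_space_def by blast
  then show ?thesis
    unfolding dual_embedding_def
    using dual_space_I[OF integral_linear_functional AE_bounded_mult(2)] by blast
qed

text \<open>The Riesz representative of a positive functional equals its projection onto the closed cone
  generated by the representatives of nonnegative bounded functions.\<close>
lemma positive_functional_approx:
  assumes f: "f \<in> V" and pos: "\<And>z. z \<in> V \<Longrightarrow> AE x in \<mu>. 0 \<le> z x \<Longrightarrow> 0 \<le> B f z" and "e > 0"
  shows "\<exists>v C. v \<in> borel_measurable \<mu> \<and> (\<forall>x. 0 \<le> v x \<and> v x \<le> C) \<and>
    (\<forall>u\<in>V. \<bar>B f u - (\<integral>x. v x * u x \<partial>\<mu>)\<bar> \<le> e * nrm u)"
proof -
  \<comment> \<open>These are the Riesz representatives of nonnegative bounded densities. They form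
    a convex cone that need not be closed, so the projection \<open>p\<close> of \<open>f\<close> is
    reached only by a sequence.\<close>
  define S where "S = {r\<in>V. \<exists>v C. v \<in> borel_measurable \<mu> \<and> (\<forall>x. 0 \<le> v x \<and> v x \<le> C) \<and>
    (\<forall>u\<in>V. B r u = (\<integral>x. v x * u x \<partial>\<mu>))}"
  have S_I: "r \<in> S" if "r \<in> V" "v \<in> borel_measurable \<mu>" "\<And>x. 0 \<le> v x \<and> v x \<le> C"
      "\<And>u. u \<in> V \<Longrightarrow> B r u = (\<integral>x. v x * u x \<partial>\<mu>)" for r v C
    using that unfolding S_def by blast
  have comb: "s *\<^sub>R r + t *\<^sub>R q \<in> S" if rq: "r \<in> S" "q \<in> S" and st: "0 \<le> s" "0 \<le> t" for r q and s t :: real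
  proof -
    obtain v C where v: "r \<in> V" "v \<in> borel_measurable \<mu>" "\<forall>x. 0 \<le> v x \<and> v x \<le> C"
      "\<forall>u\<in>V. B r u = (\<integral>x. v x * u x \<partial>\<mu>)" using rq(1) unfolding S_def by blast
    obtain w D where w: "q \<in> V" "w \<in> borel_measurable \<mu>" "\<forall>x. 0 \<le> w x \<and> w x \<le> D"
      "\<forall>u\<in>V. B q u = (\<integral>x. w x * u x \<partial>\<mu>)" using rq(2) unfolding S_def by blast
    show ?thesis
    proof (rule S_I[where v = "\<lambda>x. s * v x + t * w x" and C = "s * C + t * D"])
      show "s *\<^sub>R r + t *\<^sub>R q \<in> V" by (intro mem v w)
      show "(\<lambda>x. s * v x + t * w x) \<in> borel_measurable \<mu>" using v w by simp
      show "0 \<le> s * v x + t * w x \<and> s * v x + t * w x \<le> s * C + t * D" for x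
        using v(3) w(3) st by (auto intro!: add_mono mult_left_mono)
      show "B (s *\<^sub>R r + t *\<^sub>R q) u = (\<integral>x. (s * v x + t * w x) * u x \<partial>\<mu>)" if u: "u \<in> V" for u
      proof -
        have "integrable \<mu> (\<lambda>x. v x * u x)"
          by (rule AE_bounded_mult(1)[OF v(2) _ u, of C]) (use v(3) in auto)
        moreover have "integrable \<mu> (\<lambda>x. w x * u x)"
          by (rule AE_bounded_mult(1)[OF w(2) _ u, of D]) (use w(3) in auto)
        ultimately have "(\<integral>x. (s * v x + t * w x) * u x \<partial>\<mu>) = s * (\<integral>x. v x * u x \<partial>\<mu>) + t * (\<integral>x. w x * u x \<partial>\<mu>)"
          by (simp add: distrib_right mult.assoc)
        then show ?thesis using u v w by (simp add: expand mem)
      qed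
    qed
  qed
  have zeroS: "0 \<in> S"
    by (rule S_I[where v = "\<lambda>_. 0" and C = 0]) (use expand(2)[OF mem_zero mem_zero, of _ 0] mem_zero in auto)
  have conv: "convex S" by (rule convexI) (rule comb)
  have SV: "S \<subseteq> V" "S \<noteq> {}" using zeroS unfolding S_def by auto
  have "\<exists>s v. (\<forall>n::nat. s n \<in> S) \<and> v \<in> V \<and> (\<lambda>n. nrm (s n - v)) \<longlonglongrightarrow> 0 \<and>
    (\<forall>x\<in>S. B f (x - v) \<le> B v (x - v))"
    by (rule variational_inequality[OF linear_right[OF f] cauchy_schwarz[OF f] SV(1) conv SV(2)])
  then obtain s p where s: "\<And>n. s n \<in> S" "p \<in> V" "(\<lambda>n. nrm (s n - p)) \<longlonglongrightarrow> 0"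
    and vi: "\<And>x. x \<in> S \<Longrightarrow> B f (x - p) \<le> B p (x - p)" by blast
  have sV: "s n \<in> V" for n using s(1) SV by blast
  define d where "d = f - p"
  have dV: "d \<in> V" unfolding d_def by (intro mem f s)
  have vi': "B d x \<le> B d p" if x: "x \<in> S" for x
  proof -
    have "x \<in> V" using x SV by blast
    then show ?thesis using vi[OF x] f s(2) unfolding d_def by (simp add: expand mem)
  qed
  \<comment> \<open>Testing with 0 gives this sign; testing with \<open>s n + r\<close> shows below
    that \<open>d\<close> lies in the polar cone of \<open>S\<close>.\<close>
  have dp: "0 \<le> B d p" using vi'[OF zeroS] expand(5)[OF dV dV dV, of 0] by simp
  have dS: "B d r \<le> 0" if r: "r \<in> S" for r
  proof -
    have rV: "r \<in> V" using r SV by blast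
    have "s n + r \<in> S" for n using comb[OF s(1) r, of 1 1] by simp
    then have "B d (s n) + B d r \<le> B d p" for n using vi' dV sV rV by (simp flip: expand(4))
    moreover have "(\<lambda>n. B d (s n) + B d r) \<longlonglongrightarrow> B d p + B d r"
      by (intro tendsto_intros right_tendsto[OF dV sV s(2,3)])
    ultimately have "B d p + B d r \<le> B d p" using LIMSEQ_le_const2 by blast
    then show ?thesis by simp
  qed
  have "AE x in \<mu>. d x \<le> 0"
  proof -
    \<comment> \<open>The indicator of \<open>{d > 0}\<close> is an admissible density, so polarity
      makes the integral of the positive part of \<open>d\<close> nonpositive.\<close>
    define v where "v x = indicat_real {x. 0 < d x} x" for x
    have "{x\<in>space \<mu>. 0 < d x} \<in> sets \<mu>" using measurable_V[OF dV] by measurable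
    moreover have "space \<mu> = UNIV" using sets_eq_imp_space_eq[OF borel] by simp
    ultimately have vm: "v \<in> borel_measurable \<mu>" unfolding v_def by simp
    have v1: "0 \<le> v x \<and> v x \<le> 1" for x by (simp add: v_def indicator_def)
    then have ae: "AE x in \<mu>. \<bar>v x\<bar> \<le> 1" by simp
    obtain r where r: "r \<in> V" "\<And>u. u \<in> V \<Longrightarrow> B r u = (\<integral>x. v x * u x \<partial>\<mu>)"
      using riesz[OF integral_linear_functional[OF vm ae] AE_bounded_mult(2)[OF vm ae]] by blast
    then have "r \<in> S" using vm v1 by (intro S_I[where v = v and C = 1]) auto
    then have "B d r \<le> 0" by (rule dS)
    then have "(\<integral>x. v x * d x \<partial>\<mu>) \<le> 0" using r(2)[OF dV] commute[OF dV r(1)] by simp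
    moreover have vd: "0 \<le> v x * d x" for x by (simp add: v_def indicator_def)
    moreover have "(\<integral>x. v x * d x \<partial>\<mu>) \<ge> 0" using vd by simp
    ultimately have "AE x in \<mu>. v x * d x = 0"
      using integral_nonneg_eq_0_iff_AE[OF AE_bounded_mult(1)[OF vm ae dV]] by simp
    then show ?thesis by eventually_elim (auto simp: v_def indicator_def split: if_splits)
  qed
  then have "AE x in \<mu>. 0 \<le> (p - f) x" by eventually_elim (simp add: d_def)
  then have "0 \<le> B f (p - f)" by (intro pos mem f s)
  then have "B f d \<le> 0" unfolding d_def using f s(2) by (simp add: expand)
  \<comment> \<open>Positivity of \<open>B f\<close> on \<open>p - f\<close> makes the first term
    nonpositive, while the second one is subtracted with \<open>B d p\<close> nonnegative.\<close>
  moreover have "B d d = B f d - B d p"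
    using f s(2) dV commute[OF dV s(2)] unfolding d_def by (simp add: expand mem)
  ultimately have "B d d = 0" using dp nonneg[OF dV] by simp
  then have d0: "nrm d = 0" by (simp add: nrm_def)
  obtain n where n: "nrm (s n - p) < e"
    using order_tendstoD(2)[OF s(3) \<open>e > 0\<close>] eventually_happens[of _ sequentially] by auto
  obtain v C where v: "v \<in> borel_measurable \<mu>" "\<forall>x. 0 \<le> v x \<and> v x \<le> C"
    "\<forall>u\<in>V. B (s n) u = (\<integral>x. v x * u x \<partial>\<mu>)" using s(1)[of n] unfolding S_def by blast
  have "\<bar>B f u - (\<integral>x. v x * u x \<partial>\<mu>)\<bar> \<le> e * nrm u" if u: "u \<in> V" for u
  proof -
    have V: "f - s n \<in> V" "s n - p \<in> V" using f s(2) sV by (auto intro: mem)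
    have "f - s n = d - (s n - p)" by (simp add: d_def)
    then have "nrm (f - s n) \<le> nrm d + nrm (s n - p)" using nrm_triangle_diff[OF dV V(2)] by metis
    then have "nrm (f - s n) \<le> e" using n d0 by simp
    then have "nrm (f - s n) * nrm u \<le> e * nrm u" using nrm_nonneg[OF u] by (intro mult_right_mono)
    moreover have "B f u - (\<integral>x. v x * u x \<partial>\<mu>) = B (f - s n) u"
      using v(3) u f sV by (simp add: expand)
    ultimately show ?thesis using cauchy_schwarz[OF V(1) u] by simp
  qed
  then show ?thesis using v(1,2) by blast
qed

end

section \<open>The unit box\<close>

context dirichlet_L1
begin

text \<open>The factor \<open>1 - k\<close> is nonnegative almost everywhere, so this form displays
  the sign of a radial direction on nonnegative functions.\<close>

lemma radial_element:
  assumes k: "k \<in> unit_box \<mu>" and u: "u \<in> V"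
  shows "(t *\<^sub>R (dual_embedding \<mu> V k - dual_embedding \<mu> V (\<lambda>_. 1))) u = - t * (\<integral>x. (1 - k x) * u x \<partial>\<mu>)"
    and "integrable \<mu> (\<lambda>x. (1 - k x) * u x)"
proof -
  have km: "k \<in> borel_measurable \<mu>" and k1: "AE x in \<mu>. \<bar>k x\<bar> \<le> 1"
    using k unfolding unit_box_def Linf_space_def by (auto elim: eventually_mono simp: abs_le_iff)
  have int: "integrable \<mu> (\<lambda>x. k x * u x)" "integrable \<mu> u"
    using AE_bounded_mult(1)[OF km k1 u] integrable_V[OF u] by auto
  then show "integrable \<mu> (\<lambda>x. (1 - k x) * u x)" by (simp add: left_diff_distrib)
  have eq: "(\<integral>x. (1 - k x) * u x \<partial>\<mu>) = (\<integral>x. u x \<partial>\<mu>) - (\<integral>x. k x * u x \<partial>\<mu>)"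
    using int by (simp add: left_diff_distrib)
  show "(t *\<^sub>R (dual_embedding \<mu> V k - dual_embedding \<mu> V (\<lambda>_. 1))) u = - t * (\<integral>x. (1 - k x) * u x \<partial>\<mu>)"
    unfolding eq using u by (simp add: scaleR_fun_def dual_embedding_def right_diff_distrib)
qed

text \<open>At the constant 1 the tangent cone consists of the nonpositive functionals, while the radial
  directions annihilated by \<open>z\<close> vanish wherever \<open>z \<noteq> 0\<close>. The functional \<open>-B f\<close> is a tangent direction
  annihilated by \<open>z\<close>, but it does not vanish at \<open>\<phi>\<close>.\<close>
lemma not_polyhedric_unit_box:
  assumes f: "f \<in> V" "\<And>v. v \<in> V \<Longrightarrow> AE x in \<mu>. 0 \<le> v x \<Longrightarrow> 0 \<le> B f v"
    and z: "z \<in> V" "\<And>x. 0 \<le> z x" "B f z = 0"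
    and \<phi>: "\<phi> \<in> V" "B f \<phi> \<noteq> 0" "AE x in \<mu>. z x = 0 \<longrightarrow> \<phi> x = 0"
  shows "\<not> polyhedric (dual_space V nrm) (dual_norm V nrm) (dual_embedding \<mu> V ` unit_box \<mu>)"
proof
  define W where "W = dual_space V nrm"
  define N where "N = dual_norm V nrm"
  define K where "K = dual_embedding \<mu> V ` unit_box \<mu>"
  define w where "w = dual_embedding \<mu> V (\<lambda>_. 1)"
  \<comment> \<open>Evaluation at \<open>z\<close>, that is, \<open>z\<close> as an element of the
    bidual, extended by zero outside \<open>W\<close>.\<close>
  define \<eta> where "\<eta> \<phi> = (if \<phi> \<in> W then \<phi> z else 0)" for \<phi>
  assume "polyhedric (dual_space V nrm) (dual_norm V nrm) (dual_embedding \<mu> V ` unit_box \<mu>)"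
  then have poly: "polyhedric W N K" unfolding W_def N_def K_def .
  have Wsub: "subspace W" unfolding W_def by (rule dual_space_subspace)
  have one: "(\<lambda>_. 1) \<in> unit_box \<mu>" unfolding unit_box_def Linf_space_def by auto
  have box_Linf: "k \<in> Linf_space \<mu>" if "k \<in> unit_box \<mu>" for k using that unfolding unit_box_def by simp
  have KW: "K \<subseteq> W" unfolding K_def W_def using dual_embedding_mem box_Linf by auto
  have wK: "w \<in> K" unfolding w_def K_def using one by blast
  have radial_W: "radial_cone K w \<subseteq> W"
    unfolding radial_cone_def using KW wK Wsub by (auto intro!: subspace_scale subspace_diff)
  have radial_E: "\<exists>t k. 0 < t \<and> k \<in> unit_box \<mu> \<and> r = t *\<^sub>R (dual_embedding \<mu> V k - dual_embedding \<mu> V (\<lambda>_. 1))"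
    if "r \<in> radial_cone K w" for r
    using that unfolding radial_cone_def K_def w_def by blast
  have bound: "\<bar>\<psi> u\<bar> \<le> N \<psi> * nrm u" if "\<psi> \<in> W" "u \<in> V" for \<psi> u
    using dual_bound that unfolding W_def N_def by blast
  have approx: "\<bar>\<psi> u - \<rho> u\<bar> \<le> N (\<psi> - \<rho>) * nrm u" if "\<psi> \<in> W" "\<rho> \<in> W" "u \<in> V" for \<psi> \<rho> u
    using bound[OF subspace_diff[OF Wsub that(1,2)] that(3)] by simp
  have le_one: "AE x in \<mu>. 0 \<le> 1 - k x" if "k \<in> unit_box \<mu>" for k
    using that unfolding unit_box_def by (auto elim: eventually_mono)
  have radial_z: "r z \<le> 0" if r: "r \<in> radial_cone K w" for r
  proof -
    obtain t k where tk: "0 < t" "k \<in> unit_box \<mu>"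
      "r = t *\<^sub>R (dual_embedding \<mu> V k - dual_embedding \<mu> V (\<lambda>_. 1))" using radial_E[OF r] by blast
    have "AE x in \<mu>. 0 \<le> (1 - k x) * z x" using le_one[OF tk(2)] z(2) by (auto elim: eventually_mono)
    then have "0 \<le> (\<integral>x. (1 - k x) * z x \<partial>\<mu>)" by (rule integral_nonneg_AE)
    then show ?thesis unfolding tk(3) radial_element(1)[OF tk(2) z(1)] using tk(1) by simp
  qed
  \<comment> \<open>The divisor \<open>c + 1\<close> in the proof covers the case of seminorm
    zero.\<close>
  have small: "a \<le> 0" if a: "\<And>e. e > 0 \<Longrightarrow> a \<le> e * c" and c: "0 \<le> c" for a c :: real
  proof -
    have "a \<le> 0 + e" if e: "e > 0" for e
    proof -
      have "a \<le> e / (c + 1) * c" using a[of "e / (c + 1)"] e c by simp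
      also have "\<dots> \<le> e / (c + 1) * (c + 1)" using e c by (intro mult_left_mono) auto
      also have "\<dots> = e" using c by simp
      finally show ?thesis by simp
    qed
    then show ?thesis by (rule field_le_epsilon)
  qed
  have tangent_z: "h z \<le> 0" if h: "h \<in> tangent_cone W N K w" for h
  proof (rule small[of _ "nrm z"])
    show "0 \<le> nrm z" by (rule nrm_nonneg[OF z(1)])
    fix e :: real assume "e > 0"
    then obtain r where r: "r \<in> radial_cone K w" "N (h - r) < e" and hW: "h \<in> W"
      using h unfolding tangent_cone_def norm_closure_def by blast
    have "h z \<le> N (h - r) * nrm z" using approx[OF hW _ z(1), of r] radial_z[OF r(1)] r(1) radial_W by force
    also have "\<dots> \<le> e * nrm z" using r(2) nrm_nonneg[OF z(1)] by (intro mult_right_mono) auto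
    finally show "h z \<le> e * nrm z" .
  qed
  have "\<eta> \<in> dual_space W N"
    unfolding dual_space_def linear_functional_on_def
  proof (intro CollectI conjI ballI allI impI exI[of _ "nrm z"])
    show "\<bar>\<eta> \<psi>\<bar> \<le> nrm z * N \<psi>" if "\<psi> \<in> W" for \<psi>
      using bound[OF that z(1)] that by (simp add: \<eta>_def mult.commute)
    show "\<eta> (c *\<^sub>R \<psi>) = c * \<eta> \<psi>" if "\<psi> \<in> W" for c \<psi>
    proof -
      have "(c *\<^sub>R \<psi>) z = c * \<psi> z" by (simp add: scaleR_fun_def)
      then show ?thesis using that subspace_scale[OF Wsub that] by (simp add: \<eta>_def)
    qed
  qed (use Wsub in \<open>auto simp: \<eta>_def subspace_add\<close>)
  moreover have "\<eta> h \<le> 0" if "h \<in> tangent_cone W N K w" for h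
    using tangent_z[OF that] by (simp add: \<eta>_def)
  ultimately have "\<eta> \<in> normal_cone W N K w" unfolding normal_cone_def by blast
  then have "polyhedric_at W N K w \<eta>" using poly wK unfolding polyhedric_def by blast
  then have eq: "tangent_cone W N K w \<inter> {h\<in>W. \<eta> h = 0} = norm_closure W N (radial_cone K w \<inter> {h\<in>W. \<eta> h = 0})"
    unfolding polyhedric_at_def .
  define h where "h = (\<lambda>u. if u \<in> V then - B f u else 0)"
  have hW: "h \<in> W"
    unfolding h_def W_def
  proof (rule dual_space_I[where c = "nrm f"])
    show "linear_functional_on V (\<lambda>u. - B f u)"
      using linear_right[OF f(1)] unfolding linear_functional_on_def by simp
    show "\<bar>- B f u\<bar> \<le> nrm f * nrm u" if "u \<in> V" for u using cauchy_schwarz[OF f(1) that] by simp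
  qed
  have "\<exists>r\<in>radial_cone K w. N (h - r) < e" if e: "e > 0" for e
  proof -
    obtain v C where v: "v \<in> borel_measurable \<mu>" "\<forall>x. 0 \<le> v x \<and> v x \<le> C"
      "\<forall>u\<in>V. \<bar>B f u - (\<integral>x. v x * u x \<partial>\<mu>)\<bar> \<le> e/2 * nrm u"
      using positive_functional_approx[OF f, of "e/2"] e by auto
    have C: "0 \<le> C" using v(2) order_trans by blast
    \<comment> \<open>Scaling moves the density \<open>v\<close> into the box and the factor
      \<open>C + 1\<close> in \<open>r\<close> undoes it; the added 1 keeps the divisor positive if
      \<open>C = 0\<close>.\<close>
    define k where "k x = 1 - v x / (C + 1)" for x
    have k1: "-1 \<le> k x \<and> k x \<le> 1" for x
    proof -
      have "v x / (C + 1) \<le> 1" "0 \<le> v x / (C + 1)" using v(2)[rule_format, of x] C by auto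
      then show ?thesis unfolding k_def by linarith
    qed
    have "k \<in> Linf_space \<mu>"
      unfolding Linf_space_def using v(1) k1 by (auto simp: k_def[abs_def] abs_le_iff intro!: exI[of _ 1])
    then have k: "k \<in> unit_box \<mu>" using k1 unfolding unit_box_def by simp
    define r where "r = (C + 1) *\<^sub>R (dual_embedding \<mu> V k - dual_embedding \<mu> V (\<lambda>_. 1))"
    have "r \<in> radial_cone K w"
      unfolding radial_cone_def r_def K_def w_def using k C by force
    moreover have "N (h - r) \<le> e/2"
      unfolding N_def
    proof (rule dual_norm_le)
      fix u assume u: "u \<in> V"
      have "(\<integral>x. (1 - k x) * u x \<partial>\<mu>) = (\<integral>x. (v x * u x) / (C + 1) \<partial>\<mu>)" by (simp add: k_def)
      also have "\<dots> = (\<integral>x. v x * u x \<partial>\<mu>) / (C + 1)" by simp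
      finally have "r u = - (\<integral>x. v x * u x \<partial>\<mu>)"
        unfolding r_def radial_element(1)[OF k u] using C by (simp add: field_simps)
      then show "\<bar>(h - r) u\<bar> \<le> e/2 * nrm u" using v(3)[rule_format, OF u] u by (simp add: h_def abs_minus_commute)
    qed (use e in simp)
    ultimately show ?thesis using e by (intro bexI[of _ r]) auto
  qed
  then have "h \<in> tangent_cone W N K w" unfolding tangent_cone_def norm_closure_def using hW by blast
  moreover have "\<eta> h = 0" using hW z by (simp add: \<eta>_def h_def)
  ultimately have cl: "h \<in> norm_closure W N (radial_cone K w \<inter> {h\<in>W. \<eta> h = 0})" using eq hW by blast
  have radial_\<phi>: "r \<phi> = 0" if r: "r \<in> radial_cone K w" "r z = 0" for r
  proof -
    obtain t k where tk: "0 < t" "k \<in> unit_box \<mu>"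
      "r = t *\<^sub>R (dual_embedding \<mu> V k - dual_embedding \<mu> V (\<lambda>_. 1))" using radial_E[OF r(1)] by blast
    have pos: "AE x in \<mu>. 0 \<le> (1 - k x) * z x" using le_one[OF tk(2)] z(2) by (auto elim: eventually_mono)
    have "(\<integral>x. (1 - k x) * z x \<partial>\<mu>) = 0"
      using r(2) tk(1) unfolding tk(3) radial_element(1)[OF tk(2) z(1)] by simp
    \<comment> \<open>A nonnegative integrand with integral zero: \<open>k\<close> equals 1 almost
      everywhere on \<open>{z \<noteq> 0}\<close>, and \<open>\<phi>\<close> vanishes on the
      rest.\<close>
    then have "AE x in \<mu>. (1 - k x) * z x = 0"
      using integral_nonneg_eq_0_iff_AE[OF radial_element(2)[OF tk(2) z(1)] pos] by simp
    then have "AE x in \<mu>. (1 - k x) * \<phi> x = 0"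
      using \<phi>(3) by eventually_elim auto
    then have "(\<integral>x. (1 - k x) * \<phi> x \<partial>\<mu>) = 0" by (rule integral_eq_zero_AE)
    then show ?thesis unfolding tk(3) radial_element(1)[OF tk(2) \<phi>(1)] by simp
  qed
  have "\<bar>h \<phi>\<bar> \<le> 0"
  proof (rule small[of _ "nrm \<phi>"])
    show "0 \<le> nrm \<phi>" by (rule nrm_nonneg[OF \<phi>(1)])
    fix e :: real assume "e > 0"
    then obtain r where r: "r \<in> radial_cone K w" "r \<in> W" "\<eta> r = 0" "N (h - r) < e"
      using cl unfolding norm_closure_def by blast
    have "r \<phi> = 0" using r(2,3) by (intro radial_\<phi>[OF r(1)]) (simp add: \<eta>_def)
    then have "\<bar>h \<phi>\<bar> \<le> N (h - r) * nrm \<phi>" using approx[OF hW r(2) \<phi>(1)] by simp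
    also have "\<dots> \<le> e * nrm \<phi>" using r(4) nrm_nonneg[OF \<phi>(1)] by (intro mult_right_mono) auto
    finally show "\<bar>h \<phi>\<bar> \<le> e * nrm \<phi>" .
  qed
  then show False using \<phi>(1,2) by (simp add: h_def)
qed

end

theorem theorem3p2:
  fixes \<mu> :: "'a::metric_space measure"
    and V :: "('a \<Rightarrow> real) set"
    and E :: "('a \<Rightarrow> real) \<Rightarrow> ('a \<Rightarrow> real) \<Rightarrow> real"
  assumes "locally_compact_space (euclidean :: 'a topology)"
    and "separable_space (euclidean :: 'a topology)"
    and "sets \<mu> = sets borel"
    and "\<And>U. open U \<Longrightarrow> U \<noteq> {} \<Longrightarrow> emeasure \<mu> U > 0"
    and "\<And>K. compact K \<Longrightarrow> emeasure \<mu> K < \<infinity>"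
    and "regular_dirichlet_space \<mu> V E"
    and "V \<subseteq> L1_space \<mu>"
    and "\<exists>C. \<forall>u\<in>V. L1_norm \<mu> u \<le> C * E1_norm \<mu> E u"
    and "\<And>f e. f \<in> L1_space \<mu> \<Longrightarrow> e > 0 \<Longrightarrow> \<exists>u\<in>V. L1_norm \<mu> (f - u) < e"
    and "\<And>K. compact K \<Longrightarrow>
           \<exists>y\<in>V. quasi_continuous \<mu> V E y \<and>
             (\<exists>U. open U \<and> cap \<mu> V E (sym_diff K (U \<inter> {x. y x = 0})) = 0)"
    and "\<exists>A\<in>sets \<mu>. emeasure \<mu> A = 0 \<and> cap \<mu> V E A > 0"
  shows "\<not> polyhedric (dual_space V (E1_norm \<mu> E)) (dual_norm V (E1_norm \<mu> E))
            (dual_embedding \<mu> V ` unit_box \<mu>)"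
proof -
  obtain c1 where c1: "\<forall>u\<in>V. L1_norm \<mu> u \<le> c1 * E1_norm \<mu> E u" using assms(8) by blast
  have dir: "dirichlet_space \<mu> V E"
    and reg: "\<And>f e. f \<in> Cc_space \<Longrightarrow> e > 0 \<Longrightarrow> \<exists>w\<in>V \<inter> Cc_space. (SUP x. \<bar>f x - w x\<bar>) < e"
    using assms(6) unfolding regular_dirichlet_space_def by blast+
  interpret dirichlet \<mu> V E by unfold_locales (fact dir assms(3))+
  interpret dirichlet_L1 \<mu> V E c1
    using assms(7) c1 by unfold_locales (auto simp: L1_space_def E1_norm_eq)
  obtain Q :: "nat \<Rightarrow> 'a set" where Q: "compact_exhaustion Q"
    using compact_exhaustion_exists[OF assms(1,2)] by blast
  obtain A where A: "A \<in> sets \<mu>" "emeasure \<mu> A = 0" "capacity A > 0" using assms(11) by blast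
  obtain K where K: "compact K" "emeasure \<mu> K = 0" "capacity K > 0"
    using compact_null_set_positive_cap[OF assms(5) Q A] by blast
  obtain y U where y: "y \<in> V" "quasi_continuous \<mu> V E y"
    and U: "open U" "capacity (sym_diff K (U \<inter> {x. y x = 0})) = 0"
    using assms(10)[OF K(1)] by blast
  define D where "D = sym_diff K (U \<inter> {x. y x = 0})"
  have D: "capacity D = 0" unfolding D_def by (rule U(2))
  have cap_D: "capacity S = 0" if "S \<subseteq> D" for S using cap_mono[OF that] D by simp
  obtain C where C: "incseq C" "\<And>n::nat. compact (C n)" "(\<Union>n. C n) = U"
    using open_compact_exhaustion[OF Q U(1)] by blast
  have "\<exists>n. capacity (K \<inter> C n) > 0"
  proof (rule ccontr)
    assume "\<not> ?thesis"
    then have "capacity (K \<inter> C n) = 0" for n by simp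
    \<comment> \<open>The sets \<open>K \<inter> C n\<close> exhaust only
      \<open>K \<inter> U\<close>; adjoining the part \<open>K - U\<close>, which lies in
      \<open>D\<close>, makes the union all of \<open>K\<close>.\<close>
    then have "capacity ((K \<inter> C n) \<union> (K - U)) = 0" for n
      by (rule cap_null_Un) (rule cap_D, auto simp: D_def)
    moreover have "incseq (\<lambda>n. (K \<inter> C n) \<union> (K - U))" using C(1) unfolding incseq_def by blast
    ultimately have "capacity (\<Union>n. (K \<inter> C n) \<union> (K - U)) \<le> ennreal 0"
      by (intro cap_increasing_union) auto
    moreover have "(\<Union>n. (K \<inter> C n) \<union> (K - U)) = K" using C(3) by blast
    ultimately show False using K(3) by simp
  qed
  then obtain n where n: "capacity (K \<inter> C n) > 0" by blast
  define L where "L = K \<inter> C n"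
  have L: "compact L" "L \<subseteq> U" "capacity L > 0"
    unfolding L_def using compact_Int[OF K(1) C(2)] C(3) n by auto
  obtain \<phi> W where \<phi>: "\<phi> \<in> V" "open W" "L \<subseteq> W" "\<forall>x\<in>W. 1 \<le> \<phi> x" "\<forall>x. x \<notin> U \<longrightarrow> \<phi> x = 0"
    using compact_bump_in_V[OF L(1) U(1) L(2) Q reg] by blast
  obtain f where f: "f \<in> V" "0 < B f \<phi>"
    and f_zero: "\<forall>z O'. z \<in> V \<longrightarrow> open O' \<longrightarrow> L \<subseteq> O' \<longrightarrow> (AE x in \<mu>. x \<in> O' \<longrightarrow> z x = 0) \<longrightarrow> B f z = 0"
    and f_pos: "\<forall>z\<in>V. (AE x in \<mu>. 0 \<le> z x) \<longrightarrow> 0 \<le> B f z"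
    using capacitary_potential[OF L(3) \<phi>(1-3)] \<phi>(4) by blast
  define z where "z = trunc 1 y + trunc 1 (- y)"
  have z: "z x = min 1 \<bar>y x\<bar>" for x by (auto simp: z_def trunc_def)
  have "capacity (L \<inter> {x. y x \<noteq> 0}) = 0" by (rule cap_D) (auto simp: L_def D_def)
  then have fz: "B f z = 0"
    unfolding z_def using f_zero f_pos y by (intro potential_vanishes_on_quasi_zeros[OF f(1)]) blast+
  have space: "space \<mu> = UNIV" using sets_eq_imp_space_eq[OF borel] by simp
  have ym: "{x. y x = 0} \<in> sets \<mu>"
    using measurable_sets[OF measurable_V[OF y(1)], of "{0}"] by (simp add: space vimage_def)
  have sets: "K \<in> sets \<mu>" "U \<in> sets \<mu>" "U \<inter> {x. y x = 0} \<in> sets \<mu>"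
    using compact_imp_closed[OF K(1)] U(1) ym borel by auto
  then have "D \<in> sets \<mu>" unfolding D_def by auto
  then have "D \<in> null_sets \<mu>" using cap_zero_imp_null[OF D] by auto
  moreover have "K \<in> null_sets \<mu>" using K(2) sets by auto
  ultimately have "K \<union> D \<in> null_sets \<mu>" by (rule null_sets.Un[rotated])
  then have "AE x in \<mu>. x \<notin> K \<union> D" by (rule AE_not_in)
  then have ae: "AE x in \<mu>. z x = 0 \<longrightarrow> \<phi> x = 0"
  proof eventually_elim
    case (elim x)
    show ?case
    proof
      assume "z x = 0"
      then have "y x = 0" by (simp add: z min_def split: if_splits)
      \<comment> \<open>A point of \<open>U\<close> with \<open>y x = 0\<close> outside
        \<open>K\<close> would lie in the symmetric difference \<open>D\<close>.\<close>
      then have "x \<notin> U" using elim unfolding D_def by blast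
      then show "\<phi> x = 0" using \<phi>(5) by blast
    qed
  qed
  have zV: "z \<in> V" unfolding z_def using y(1) markov(1) by (intro mem) (auto intro: mem)
  show ?thesis
    unfolding E1_norm_eq
    by (rule not_polyhedric_unit_box[OF f(1) _ zV _ fz \<phi>(1) _ ae]) (use f_pos f(2) z in auto)
qed

end
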